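(* Let $\theta$ be an action of an inverse semigroup $S$ on a locally compact Hausdorff space $X$. Then for any $g\in\mathcal C(S\ltimes X^{\mathrm{KS}})$, $$\|g\|_r=\sup\{\|\lambda_{\tau_{e,x}}(g)\|\mid e\in E(S),\ x\in X_e\}.$$
   Context: An inverse semigroup is a semigroup $S$ in which every $s$ has a unique $s^*$ with $ss^*s=s$, $s^*ss^*=s^*$; $E(S)$ is its commutative subsemigroup of idempotents; $s\le t$ means $ts^*s=s$. An action $\theta$ of $S$ on a topological space $X$ is a semigroup homomorphism $s\mapsto\theta_s$ from $S$ to the inverse semigroup of partial bijections of $X$ (bijections between subsets, composed on the largest possible domain) such that, writing $X_e$ for the subset on which $\theta_e$ ($e\in E(S)$) is the identity (so $\theta_s$ is a bijection $X_{s^*s}\to X_{ss^*}$): each $X_e$ is open, each $\theta_s\colon X_{s^*s}\to X_{ss^*}$ is continuous, and $\bigcup_{e\in E(S)}X_e=X$. The space $X^{\mathrm{KS}}$: let $\widetilde{X_e}=X_e\sqcup\{\infty_e\}$ be the one-point compactification of $X_e$ (a point $\infty_e$ is added even when $X_e$ is compact). Let $\widetilde{X^{\mathrm{KS}}}$ be the set of $\tau\in\prod_{e\in E(S)}\widetilde{X_e}$ such that (1) if $e_1\le e_2$ and $\tau(e_1)\ne\infty_{e_1}$, then $\tau(e_2)=\tau(e_1)$; (2) if $\tau(e_1)\neq\infty_{e_1}$ and $\tau(e_2)\neq\infty_{e_2}$, then $\tau(e_1e_2)\neq\infty_{e_1e_2}$; with the topology induced from the product topology. Set $X^{\mathrm{KS}}=\widetilde{X^{\mathrm{KS}}}\setminus\{\infty\}$,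 $\infty=(\infty_e)_e$; it is locally compact Hausdorff. $S$ acts on $X^{\mathrm{KS}}$ by $X^{\mathrm{KS}}_e=\{\tau\in X^{\mathrm{KS}}\mid\tau(e)\ne\infty_e\}$ and $\theta^{\mathrm{KS}}_s\colon X^{\mathrm{KS}}_{s^*s}\to X^{\mathrm{KS}}_{ss^*}$, $\theta^{\mathrm{KS}}_s(\tau)(e)=\theta_{es}(\tau(s^*es))$ if $\tau(s^*es)\neq\infty_{s^*es}$ and $\infty_e$ otherwise. For $e\in E(S)$ and $x\in X_e$, $\tau_{e,x}\in X^{\mathrm{KS}}$ is defined by $\tau_{e,x}(f)=x$ if $e\le f$ and $\tau_{e,x}(f)=\infty_f$ otherwise ($f\in E(S)$). Transformation groupoid: for an action $\theta$ of $S$ on a locally compact Hausdorff space $Z$, $S\ltimes Z$ is the set of classes $[s,z]$ of pairs $(s,z)$, $z\in Z_{s^*s}$, under $(s,z)\sim(t,w)$ iff $z=w$ and $se=te$, $z\in Z_e$ for some $e\in E(S)$; unit space $\{[e,z]\}$ identified with $Z$, $d([s,z])=z$, $r([s,z])=\theta_s(z)$, $[t,\theta_s(z)][s,z]=[ts,z]$, $[s,z]^{-1}=[s^*,\theta_s(z)]$; basis of open sets $[s,U]=\{[s,z]\mid z\in U\}$, $U\subset Z_{s^*s}$ open. It is an étale groupoid (possibly non-Hausdorff). For an étale groupoid $G$ (unit space locally compact Hausdorff), $\mathcal C(G)$ is the linear span in $\mathbb C^G$ of all $C_c(U)$, $U\subset G$ open bisection (open subset on which $d$ and $r$ are injective),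 functions being extended by zero. With $G_x=\{\gamma\mid d(\gamma)=x\}$, the left regular representation at $x\in G^{(0)}$ is $\lambda_x\colon\mathcal C(G)\to\mathbb B(l^2(G_x))$, $\lambda_x(f)\delta_\gamma=\sum_{\beta\in G_{r(\gamma)}}f(\beta)\delta_{\beta\gamma}$, and $\|f\|_r=\sup_{x\in G^{(0)}}\|\lambda_x(f)\|$. *)

theory Defs
  imports "HOL-Analysis.Analysis" "HOL-Library.Function_Algebras"
begin

section \<open>Inverse semigroups and their actions\<close>

class inverse_semigroup = semigroup_mult +
  assumes ex1_star: "\<exists>!t. s * t * s = s \<and> t * s * t = t"

definition star :: "'s::inverse_semigroup \<Rightarrow> 's" where
  "star s = (THE t. s * t * s = s \<and> t * s * t = t)"

definition idems :: "'s::inverse_semigroup set" where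
  "idems = {e. e * e = e}"

definition nat_le :: "'s::inverse_semigroup \<Rightarrow> 's \<Rightarrow> bool" where
  "nat_le s t \<longleftrightarrow> t * star s * s = s"

text \<open>
  A partial bijection is a map \<open>'x \<rightharpoonup> 'x\<close> that is injective on its domain;
  \<open>\<circ>\<^sub>m\<close> is composition on the largest possible domain.
\<close>

definition act_dom :: "('s \<Rightarrow> 'x \<rightharpoonup> 'x) \<Rightarrow> 's \<Rightarrow> 'x set" where
  "act_dom \<theta> e = {x. \<theta> e x = Some x}"

locale inverse_semigroup_action =
  fixes X :: "'x topology" and \<theta> :: "'s::inverse_semigroup \<Rightarrow> 'x \<rightharpoonup> 'x"
  assumes dom_subset: "dom (\<theta> s) \<subseteq> topspace X"
    and ran_subset: "ran (\<theta> s) \<subseteq> topspace X"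
    and inj_act: "inj_on (\<theta> s) (dom (\<theta> s))"
    and act_mult: "\<theta> (s * t) = \<theta> s \<circ>\<^sub>m \<theta> t"
    and open_act_dom: "e \<in> idems \<Longrightarrow> openin X (act_dom \<theta> e)"
    and continuous_act:
      "continuous_map (subtopology X (act_dom \<theta> (star s * s)))
         (subtopology X (act_dom \<theta> (s * star s))) (\<lambda>x. the (\<theta> s x))"
    and Union_act_dom: "(\<Union>e\<in>idems. act_dom \<theta> e) = topspace X"

section \<open>The space \<open>X\<^sup>K\<^sup>S\<close>\<close>

text \<open>
  The added point \<open>\<infinity>\<^sub>e\<close> is \<^term>\<open>None\<close>, and \<open>x \<in> X\<^sub>e\<close> is \<open>Some x\<close>. Elements of the product
  are extensional functions on \<^term>\<open>idems\<close>.
\<close>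

definition KS_product ::
    "'x topology \<Rightarrow> ('s::inverse_semigroup \<Rightarrow> 'x \<rightharpoonup> 'x) \<Rightarrow> ('s \<Rightarrow> 'x option) topology" where
  "KS_product X \<theta> =
     product_topology (\<lambda>e. Alexandroff_compactification (subtopology X (act_dom \<theta> e))) idems"

definition KS_tilde ::
    "'x topology \<Rightarrow> ('s::inverse_semigroup \<Rightarrow> 'x \<rightharpoonup> 'x) \<Rightarrow> ('s \<Rightarrow> 'x option) set" where
  "KS_tilde X \<theta> = {\<tau> \<in> topspace (KS_product X \<theta>).
     (\<forall>e1\<in>idems. \<forall>e2\<in>idems. nat_le e1 e2 \<and> \<tau> e1 \<noteq> None \<longrightarrow> \<tau> e2 = \<tau> e1) \<and>
     (\<forall>e1\<in>idems. \<forall>e2\<in>idems. \<tau> e1 \<noteq> None \<and> \<tau> e2 \<noteq> None \<longrightarrow> \<tau> (e1 * e2) \<noteq> None)}"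

definition KS_infinity :: "'s::inverse_semigroup \<Rightarrow> 'x option" where
  "KS_infinity = (\<lambda>e\<in>idems. None)"

definition KS_space ::
    "'x topology \<Rightarrow> ('s::inverse_semigroup \<Rightarrow> 'x \<rightharpoonup> 'x) \<Rightarrow> ('s \<Rightarrow> 'x option) topology" where
  "KS_space X \<theta> = subtopology (KS_product X \<theta>) (KS_tilde X \<theta> - {KS_infinity})"

definition KS_act ::
    "'x topology \<Rightarrow> ('s::inverse_semigroup \<Rightarrow> 'x \<rightharpoonup> 'x) \<Rightarrow>
     's \<Rightarrow> ('s \<Rightarrow> 'x option) \<rightharpoonup> ('s \<Rightarrow> 'x option)" where
  "KS_act X \<theta> s \<tau> =
     (if \<tau> \<in> topspace (KS_space X \<theta>) \<and> \<tau> (star s * s) \<noteq> None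
      then Some (\<lambda>e\<in>idems. case \<tau> (star s * e * s) of None \<Rightarrow> None | Some x \<Rightarrow> \<theta> (e * s) x)
      else None)"

definition KS_point :: "'s::inverse_semigroup \<Rightarrow> 'x \<Rightarrow> 's \<Rightarrow> 'x option" where
  "KS_point e x = (\<lambda>f\<in>idems. if nat_le e f then Some x else None)"

section \<open>Topological groupoids and the transformation groupoid\<close>

text \<open>
  The unit space is kept as a space of its own type; \<^term>\<open>unit_arrow\<close> embeds it into the arrows.
  The product \<open>gmult \<beta> \<gamma>\<close> is meaningful only when \<open>src \<beta> = tgt \<gamma>\<close>.
\<close>

record ('g, 'u) top_groupoid =
  arrow_top :: "'g topology"
  unit_top :: "'u topology"
  src :: "'g \<Rightarrow> 'u"
  tgt :: "'g \<Rightarrow> 'u"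
  unit_arrow :: "'u \<Rightarrow> 'g"
  gmult :: "'g \<Rightarrow> 'g \<Rightarrow> 'g"
  ginv :: "'g \<Rightarrow> 'g"

definition germ_rel :: "('s::inverse_semigroup \<Rightarrow> 'z \<rightharpoonup> 'z) \<Rightarrow> (('s \<times> 'z) \<times> ('s \<times> 'z)) set" where
  "germ_rel \<theta> = {((s, z), (t, w)). z \<in> act_dom \<theta> (star s * s) \<and> w \<in> act_dom \<theta> (star t * t) \<and>
     z = w \<and> (\<exists>e\<in>idems. s * e = t * e \<and> z \<in> act_dom \<theta> e)}"

definition germ :: "('s::inverse_semigroup \<Rightarrow> 'z \<rightharpoonup> 'z) \<Rightarrow> 's \<Rightarrow> 'z \<Rightarrow> ('s \<times> 'z) set" where
  "germ \<theta> s z = germ_rel \<theta> `` {(s, z)}"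

text \<open>
  In \<open>unit_arrow\<close>, \<open>gmult\<close> and \<open>ginv\<close> all representatives yield the same class, so each union
  is that class. The sets \<open>[s,U]\<close> form a basis, so generating from them as a subbasis
  gives the same topology; their union is the set of all germs.
\<close>

definition transformation_groupoid ::
    "'z topology \<Rightarrow> ('s::inverse_semigroup \<Rightarrow> 'z \<rightharpoonup> 'z) \<Rightarrow> (('s \<times> 'z) set, 'z) top_groupoid" where
  "transformation_groupoid Z \<theta> = \<lparr>
     arrow_top = topology_generated_by
       {germ \<theta> s ` U | s U. openin Z U \<and> U \<subseteq> act_dom \<theta> (star s * s)},
     unit_top = Z,
     src = (\<lambda>\<gamma>. THE z. \<exists>s. (s, z) \<in> \<gamma>),
     tgt = (\<lambda>\<gamma>. THE w. \<exists>s z. (s, z) \<in> \<gamma> \<and> \<theta> s z = Some w),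
     unit_arrow = (\<lambda>z. \<Union>{germ \<theta> e z | e. e \<in> idems \<and> z \<in> act_dom \<theta> e}),
     gmult = (\<lambda>\<beta> \<gamma>. \<Union>{germ \<theta> (t * s) z | t s z w. (t, w) \<in> \<beta> \<and> (s, z) \<in> \<gamma> \<and> \<theta> s z = Some w}),
     ginv = (\<lambda>\<gamma>. \<Union>{germ \<theta> (star s) w | s z w. (s, z) \<in> \<gamma> \<and> \<theta> s z = Some w})\<rparr>"

section \<open>The algebra \<open>C(G)\<close>\<close>

definition open_bisection :: "('g, 'u) top_groupoid \<Rightarrow> 'g set \<Rightarrow> bool" where
  "open_bisection G U \<longleftrightarrow>
     openin (arrow_top G) U \<and> inj_on (src G) U \<and> inj_on (tgt G) U"

text \<open>Functions are extended by zero, also outside the set of arrows; the support is taken in \<open>U\<close>.\<close>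

definition Cc_on :: "'g topology \<Rightarrow> 'g set \<Rightarrow> ('g \<Rightarrow> complex) set" where
  "Cc_on T U = {f. continuous_map (subtopology T U) euclidean f \<and>
     compactin (subtopology T U) (subtopology T U closure_of {\<gamma> \<in> U. f \<gamma> \<noteq> 0}) \<and>
     (\<forall>\<gamma>. \<gamma> \<notin> U \<longrightarrow> f \<gamma> = 0)}"

interpretation complex_fun: vector_space "\<lambda>(c::complex) (f::'g \<Rightarrow> complex) \<gamma>. c * f \<gamma>"
  by unfold_locales (auto simp: algebra_simps)

definition conv_algebra :: "('g, 'u) top_groupoid \<Rightarrow> ('g \<Rightarrow> complex) set" where
  "conv_algebra G = complex_fun.span (\<Union>{Cc_on (arrow_top G) U | U. open_bisection G U})"

section \<open>Square-summable functions and bounded operators\<close>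

text \<open>\<open>l\<^sup>2(A)\<close> consists of functions on the whole type that vanish outside \<open>A\<close>.\<close>

definition ell2 :: "'g set \<Rightarrow> ('g \<Rightarrow> complex) set" where
  "ell2 A = {\<xi>. (\<forall>\<gamma>. \<gamma> \<notin> A \<longrightarrow> \<xi> \<gamma> = 0) \<and> (\<lambda>\<gamma>. (cmod (\<xi> \<gamma>))\<^sup>2) summable_on A}"

definition ell2_norm :: "'g set \<Rightarrow> ('g \<Rightarrow> complex) \<Rightarrow> real" where
  "ell2_norm A \<xi> = sqrt (\<Sum>\<^sub>\<infinity>\<gamma>\<in>A. (cmod (\<xi> \<gamma>))\<^sup>2)"

definition bounded_ops :: "'g set \<Rightarrow> (('g \<Rightarrow> complex) \<Rightarrow> ('g \<Rightarrow> complex)) set" where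
  "bounded_ops A = {T. T \<in> ell2 A \<rightarrow>\<^sub>E ell2 A \<and>
     (\<forall>\<xi>\<in>ell2 A. \<forall>\<eta>\<in>ell2 A. T (\<lambda>\<gamma>. \<xi> \<gamma> + \<eta> \<gamma>) = (\<lambda>\<gamma>. T \<xi> \<gamma> + T \<eta> \<gamma>)) \<and>
     (\<forall>c. \<forall>\<xi>\<in>ell2 A. T (\<lambda>\<gamma>. c * \<xi> \<gamma>) = (\<lambda>\<gamma>. c * T \<xi> \<gamma>)) \<and>
     (\<exists>K. \<forall>\<xi>\<in>ell2 A. ell2_norm A (T \<xi>) \<le> K * ell2_norm A \<xi>)}"

definition op_norm :: "'g set \<Rightarrow> (('g \<Rightarrow> complex) \<Rightarrow> ('g \<Rightarrow> complex)) \<Rightarrow> real" where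
  "op_norm A T = Sup {ell2_norm A (T \<xi>) | \<xi>. \<xi> \<in> ell2 A \<and> ell2_norm A \<xi> \<le> 1}"

definition delta :: "'g \<Rightarrow> 'g \<Rightarrow> complex" where
  "delta \<gamma> = (\<lambda>\<alpha>. if \<alpha> = \<gamma> then 1 else 0)"

section \<open>Left regular representations and the reduced norm\<close>

definition src_fiber :: "('g, 'u) top_groupoid \<Rightarrow> 'u \<Rightarrow> 'g set" where
  "src_fiber G x = {\<gamma> \<in> topspace (arrow_top G). src G \<gamma> = x}"

text \<open>
  The operator is determined by its values on the \<open>delta \<gamma>\<close>. For \<open>f\<close> in \<open>C(G)\<close> the sum
  over \<open>\<beta>\<close> has only finitely many nonzero terms, so taking it pointwise is harmless. Likewise
  the real suprema in \<open>op_norm\<close> and \<open>reduced_norm\<close> are over bounded sets for such \<open>f\<close>.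
\<close>

definition left_regular ::
    "('g, 'u) top_groupoid \<Rightarrow> 'u \<Rightarrow> ('g \<Rightarrow> complex) \<Rightarrow> ('g \<Rightarrow> complex) \<Rightarrow> ('g \<Rightarrow> complex)" where
  "left_regular G x f = (THE T. T \<in> bounded_ops (src_fiber G x) \<and>
     (\<forall>\<gamma>\<in>src_fiber G x.
        T (delta \<gamma>) = (\<lambda>\<alpha>. \<Sum>\<^sub>\<infinity>\<beta>\<in>src_fiber G (tgt G \<gamma>). f \<beta> * delta (gmult G \<beta> \<gamma>) \<alpha>)))"

definition left_regular_norm :: "('g, 'u) top_groupoid \<Rightarrow> 'u \<Rightarrow> ('g \<Rightarrow> complex) \<Rightarrow> real" where
  "left_regular_norm G x f = op_norm (src_fiber G x) (left_regular G x f)"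

definition reduced_norm :: "('g, 'u) top_groupoid \<Rightarrow> ('g \<Rightarrow> complex) \<Rightarrow> real" where
  "reduced_norm G f = Sup {left_regular_norm G x f | x. x \<in> topspace (unit_top G)}"

end

theory Submission
  imports Defs
begin

text \<open>
  A point of \<open>X\<^sup>K\<^sup>S\<close> is the same thing as a pair \<open>(F, x)\<close>: a filter \<open>F\<close> of idempotents, namely those
  \<open>e\<close> with \<open>\<tau>(e) \<noteq> \<infinity>\<^sub>e\<close>, and a point \<open>x\<close> lying in \<open>X\<^sub>e\<close> for all \<open>e \<in> F\<close>, the common value of \<open>\<tau>\<close> on \<open>F\<close>
  (\<open>KS_space_cases\<close>). The points \<open>\<tau>\<^sub>e\<^sub>,\<^sub>x\<close> are those with a principal filter. When \<open>e\<close> runs downwards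
  through \<open>F\<close>, every coordinate of \<open>\<tau>\<^sub>e\<^sub>,\<^sub>x\<close> is eventually equal to that of \<open>\<tau> = (F, x)\<close>, so
  \<open>\<tau>\<^sub>e\<^sub>,\<^sub>x \<rightarrow> \<tau>\<close>.

  In a non-Hausdorff groupoid, convergence of units is too weak to compare regular representations:
  the units could also accumulate at a nontrivial isotropy element over \<open>\<tau>\<close>. Here this does not
  happen. If \<open>[s, \<tau>\<^sub>e\<^sub>,\<^sub>x] = [t, \<tau>\<^sub>e\<^sub>,\<^sub>x]\<close> with \<open>e \<in> F\<close>, then \<open>se = te\<close>, and \<open>e \<in> F\<close> then gives
  \<open>[s, \<tau>] = [t, \<tau>]\<close> (\<open>KS_point_separates_germs\<close>). So distinct germs at \<open>\<tau>\<close> remain distinct along the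
  approximation. From this, \<open>g([s, \<tau>\<^sub>e\<^sub>,\<^sub>x]) \<rightarrow> g([s, \<tau>])\<close> for all \<open>g \<in> C(G)\<close>
  (\<open>tendsto_conv_algebra_germ\<close>), although \<open>g\<close> need not be continuous.

  The matrix of \<open>\<lambda>\<^sub>\<tau>(g)\<close> has the entries \<open>g(\<alpha>\<gamma>\<^sup>-\<^sup>1)\<close>, and its norm is the supremum of the norms of its
  finite sections. Moving the finitely many germs of a section from \<open>\<tau>\<close> to \<open>\<tau>\<^sub>e\<^sub>,\<^sub>x\<close> turns it into a
  section of the matrix of \<open>\<lambda>(g)\<close> at \<open>\<tau>\<^sub>e\<^sub>,\<^sub>x\<close>, with entries converging to the original ones. Hence
  \<open>\<parallel>\<lambda>\<^sub>\<tau>(g)\<parallel>\<close> is at most every bound that holds for all \<open>\<tau>\<^sub>e\<^sub>,\<^sub>x\<close> with \<open>e \<in> F\<close>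
  (\<open>left_regular_norm_le_limit\<close>).
\<close>

section \<open>Matrices and operators on square-summable functions\<close>

lemma ell2_norm_nonneg: "0 \<le> ell2_norm A \<xi>"
  by (simp add: ell2_norm_def infsum_nonneg)

lemma ell2_norm_power2: "(ell2_norm A \<xi>)\<^sup>2 = (\<Sum>\<^sub>\<infinity>\<gamma>\<in>A. (cmod (\<xi> \<gamma>))\<^sup>2)"
  by (simp add: ell2_norm_def infsum_nonneg)

lemma ell2_bounded_sums:
  assumes "\<And>\<gamma>. \<gamma> \<notin> A \<Longrightarrow> \<xi> \<gamma> = 0"
    and bound: "\<And>F. finite F \<Longrightarrow> F \<subseteq> A \<Longrightarrow> (\<Sum>\<gamma>\<in>F. (cmod (\<xi> \<gamma>))\<^sup>2) \<le> B"
  shows "\<xi> \<in> ell2 A" and "(ell2_norm A \<xi>)\<^sup>2 \<le> B"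
proof -
  have *: "(\<lambda>\<gamma>. (cmod (\<xi> \<gamma>))\<^sup>2) summable_on A"
    by (rule nonneg_bdd_above_summable_on) (auto intro!: bdd_aboveI2[where M = B] bound)
  then show "\<xi> \<in> ell2 A" using assms(1) by (simp add: ell2_def)
  show "(ell2_norm A \<xi>)\<^sup>2 \<le> B"
    unfolding ell2_norm_power2 by (rule infsum_le_finite_sums[OF * bound])
qed

lemma ell2_finite_sum_le:
  assumes "\<xi> \<in> ell2 A" "finite F" "F \<subseteq> A"
  shows "(\<Sum>\<gamma>\<in>F. (cmod (\<xi> \<gamma>))\<^sup>2) \<le> (ell2_norm A \<xi>)\<^sup>2"
  unfolding ell2_norm_power2 by (rule finite_sum_le_infsum) (use assms in \<open>auto simp: ell2_def\<close>)

lemma ell2_point_le: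
  assumes "\<xi> \<in> ell2 A"
  shows "cmod (\<xi> \<gamma>) \<le> ell2_norm A \<xi>"
proof (cases "\<gamma> \<in> A")
  case True
  then have "(cmod (\<xi> \<gamma>))\<^sup>2 \<le> (ell2_norm A \<xi>)\<^sup>2"
    using ell2_finite_sum_le[OF assms, of "{\<gamma>}"] by simp
  then show ?thesis using ell2_norm_nonneg power2_le_imp_le by blast
qed (use assms in \<open>simp add: ell2_def ell2_norm_nonneg\<close>)

lemma ell2_add:
  assumes "\<xi> \<in> ell2 A" "\<eta> \<in> ell2 A"
  shows "(\<lambda>\<gamma>. \<xi> \<gamma> + \<eta> \<gamma>) \<in> ell2 A"
proof (rule ell2_bounded_sums(1))
  fix F assume F: "finite F" "F \<subseteq> A"
  have "(cmod (\<xi> \<gamma> + \<eta> \<gamma>))\<^sup>2 \<le> 2 * (cmod (\<xi> \<gamma>))\<^sup>2 + 2 * (cmod (\<eta> \<gamma>))\<^sup>2" for \<gamma>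
  proof -
    have "(cmod (\<xi> \<gamma> + \<eta> \<gamma>))\<^sup>2 \<le> (cmod (\<xi> \<gamma>) + cmod (\<eta> \<gamma>))\<^sup>2"
      by (simp add: norm_triangle_ineq power_mono)
    also have "\<dots> \<le> 2 * (cmod (\<xi> \<gamma>))\<^sup>2 + 2 * (cmod (\<eta> \<gamma>))\<^sup>2"
      using sum_squares_bound[of "cmod (\<xi> \<gamma>)" "cmod (\<eta> \<gamma>)"] by (simp add: power2_sum)
    finally show ?thesis .
  qed
  then have "(\<Sum>\<gamma>\<in>F. (cmod (\<xi> \<gamma> + \<eta> \<gamma>))\<^sup>2)
      \<le> (\<Sum>\<gamma>\<in>F. 2 * (cmod (\<xi> \<gamma>))\<^sup>2 + 2 * (cmod (\<eta> \<gamma>))\<^sup>2)"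
    by (rule sum_mono)
  also have "\<dots> \<le> 2 * (ell2_norm A \<xi>)\<^sup>2 + 2 * (ell2_norm A \<eta>)\<^sup>2"
    using ell2_finite_sum_le[OF assms(1) F] ell2_finite_sum_le[OF assms(2) F]
    by (simp add: sum.distrib flip: sum_distrib_left)
  finally show "(\<Sum>\<gamma>\<in>F. (cmod (\<xi> \<gamma> + \<eta> \<gamma>))\<^sup>2)
      \<le> 2 * (ell2_norm A \<xi>)\<^sup>2 + 2 * (ell2_norm A \<eta>)\<^sup>2" .
qed (use assms in \<open>auto simp: ell2_def\<close>)

lemma ell2_scale:
  assumes "\<xi> \<in> ell2 A"
  shows "(\<lambda>\<gamma>. c * \<xi> \<gamma>) \<in> ell2 A"
  using assms by (auto simp: ell2_def norm_mult power_mult_distrib intro: summable_on_cmult_right)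

lemma ell2_norm_scale: "ell2_norm A (\<lambda>\<gamma>. c * \<xi> \<gamma>) = cmod c * ell2_norm A \<xi>"
  by (simp add: ell2_norm_def norm_mult power_mult_distrib infsum_cmult_right' real_sqrt_mult)

lemma ell2_finite_support:
  assumes "finite P" "P \<subseteq> A"
  shows "(\<lambda>\<gamma>. if \<gamma> \<in> P then \<xi> \<gamma> else 0) \<in> ell2 A"
    and "(ell2_norm A (\<lambda>\<gamma>. if \<gamma> \<in> P then \<xi> \<gamma> else 0))\<^sup>2 = (\<Sum>\<gamma>\<in>P. (cmod (\<xi> \<gamma>))\<^sup>2)"
proof -
  have *: "((\<lambda>\<gamma>. (cmod (if \<gamma> \<in> P then \<xi> \<gamma> else 0))\<^sup>2) has_sum (\<Sum>\<gamma>\<in>P. (cmod (\<xi> \<gamma>))\<^sup>2)) A"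
    by (rule has_sum_finite_neutralI[of P]) (use assms in auto)
  then show "(\<lambda>\<gamma>. if \<gamma> \<in> P then \<xi> \<gamma> else 0) \<in> ell2 A"
    using assms by (auto simp: ell2_def summable_on_def)
  show "(ell2_norm A (\<lambda>\<gamma>. if \<gamma> \<in> P then \<xi> \<gamma> else 0))\<^sup>2 = (\<Sum>\<gamma>\<in>P. (cmod (\<xi> \<gamma>))\<^sup>2)"
    unfolding ell2_norm_power2 using * by (rule infsumI)
qed

lemma delta_in_ell2: "\<gamma> \<in> A \<Longrightarrow> delta \<gamma> \<in> ell2 A"
  using ell2_finite_support(1)[of "{\<gamma>}" A "\<lambda>_. 1"] by (simp add: delta_def)

text \<open>
  Finitely supported functions are dense; this is what lets the values on the \<open>delta \<gamma>\<close> determine a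
  bounded operator.
\<close>

lemma ell2_tail_tendsto_0:
  assumes "\<xi> \<in> ell2 A"
  shows "((\<lambda>P. ell2_norm A (\<lambda>\<gamma>. if \<gamma> \<in> P then 0 else \<xi> \<gamma>)) \<longlongrightarrow> 0) (finite_subsets_at_top A)"
proof -
  let ?tail = "\<lambda>P \<gamma>. if \<gamma> \<in> P then 0 else \<xi> \<gamma>"
  have sm: "(\<lambda>\<gamma>. (cmod (\<xi> \<gamma>))\<^sup>2) summable_on A" using assms by (simp add: ell2_def)
  have eq: "(ell2_norm A (?tail P))\<^sup>2 = (ell2_norm A \<xi>)\<^sup>2 - (\<Sum>\<gamma>\<in>P. (cmod (\<xi> \<gamma>))\<^sup>2)"
    if P: "finite P" "P \<subseteq> A" for P
  proof -
    have "((\<lambda>\<gamma>. (cmod (if \<gamma> \<in> P then \<xi> \<gamma> else 0))\<^sup>2) has_sum (\<Sum>\<gamma>\<in>P. (cmod (\<xi> \<gamma>))\<^sup>2)) A"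
      by (rule has_sum_finite_neutralI[of P]) (use P in auto)
    moreover have "((\<lambda>\<gamma>. (cmod (\<xi> \<gamma>))\<^sup>2) has_sum (ell2_norm A \<xi>)\<^sup>2) A"
      unfolding ell2_norm_power2 using sm by (rule has_sum_infsum)
    ultimately have "((\<lambda>\<gamma>. (cmod (\<xi> \<gamma>))\<^sup>2 - (cmod (if \<gamma> \<in> P then \<xi> \<gamma> else 0))\<^sup>2) has_sum
        ((ell2_norm A \<xi>)\<^sup>2 - (\<Sum>\<gamma>\<in>P. (cmod (\<xi> \<gamma>))\<^sup>2))) A"
      using has_sum_add[OF _ has_sum_cmult_right[where c = "-1"]] by fastforce
    moreover have "(\<lambda>\<gamma>. (cmod (\<xi> \<gamma>))\<^sup>2 - (cmod (if \<gamma> \<in> P then \<xi> \<gamma> else 0))\<^sup>2)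
        = (\<lambda>\<gamma>. (cmod (?tail P \<gamma>))\<^sup>2)"
      by auto
    ultimately show ?thesis unfolding ell2_norm_power2[of A "?tail P"] by (simp add: infsumI)
  qed
  have "((\<lambda>P. (ell2_norm A \<xi>)\<^sup>2 - (\<Sum>\<gamma>\<in>P. (cmod (\<xi> \<gamma>))\<^sup>2)) \<longlongrightarrow> 0) (finite_subsets_at_top A)"
    using tendsto_diff[OF tendsto_const infsum_tendsto[OF sm], of "(ell2_norm A \<xi>)\<^sup>2"]
    by (simp add: ell2_norm_power2)
  then have "((\<lambda>P. (ell2_norm A (?tail P))\<^sup>2) \<longlongrightarrow> 0) (finite_subsets_at_top A)"
    by (rule Lim_transform_eventually)
      (auto intro!: eventually_finite_subsets_at_top_weakI simp: eq)
  then have "((\<lambda>P. sqrt ((ell2_norm A (?tail P))\<^sup>2)) \<longlongrightarrow> sqrt 0) (finite_subsets_at_top A)"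
    by (rule tendsto_real_sqrt)
  then show ?thesis by (simp add: ell2_norm_nonneg)
qed

text \<open>
  The matrix is read off on the basis vectors, so for a groupoid fibre this is the defining property
  of the left regular representation.
\<close>

definition has_matrix ::
    "'g set \<Rightarrow> (('g \<Rightarrow> complex) \<Rightarrow> ('g \<Rightarrow> complex)) \<Rightarrow> ('g \<Rightarrow> 'g \<Rightarrow> complex) \<Rightarrow> bool" where
  "has_matrix A T k \<longleftrightarrow> T \<in> bounded_ops A \<and>
     (\<forall>\<gamma>\<in>A. T (delta \<gamma>) = (\<lambda>\<alpha>. if \<alpha> \<in> A then k \<alpha> \<gamma> else 0))"

text \<open>
  A finite section is the block of the matrix with columns in \<open>P\<close> and rows in \<open>Q\<close>. Only finite sums
  occur, so this bound passes to limits of matrices, while it still determines the operator norm.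
\<close>

definition sections_bounded :: "'g set \<Rightarrow> ('g \<Rightarrow> 'g \<Rightarrow> complex) \<Rightarrow> real \<Rightarrow> bool" where
  "sections_bounded A k C \<longleftrightarrow> (\<forall>P Q \<xi>. finite P \<longrightarrow> finite Q \<longrightarrow> P \<subseteq> A \<longrightarrow> Q \<subseteq> A \<longrightarrow>
     (\<Sum>\<alpha>\<in>Q. (cmod (\<Sum>\<gamma>\<in>P. k \<alpha> \<gamma> * \<xi> \<gamma>))\<^sup>2) \<le> C\<^sup>2 * (\<Sum>\<gamma>\<in>P. (cmod (\<xi> \<gamma>))\<^sup>2))"

lemma sections_boundedD:
  assumes "sections_bounded A k C" "finite P" "finite Q" "P \<subseteq> A" "Q \<subseteq> A"
  shows "(\<Sum>\<alpha>\<in>Q. (cmod (\<Sum>\<gamma>\<in>P. k \<alpha> \<gamma> * \<xi> \<gamma>))\<^sup>2) \<le> C\<^sup>2 * (\<Sum>\<gamma>\<in>P. (cmod (\<xi> \<gamma>))\<^sup>2)"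
  using assms by (auto simp: sections_bounded_def)

lemma bounded_opsD:
  assumes "T \<in> bounded_ops A"
  shows "\<xi> \<in> ell2 A \<Longrightarrow> T \<xi> \<in> ell2 A"
    and "\<xi> \<in> ell2 A \<Longrightarrow> \<eta> \<in> ell2 A \<Longrightarrow> T (\<lambda>\<gamma>. \<xi> \<gamma> + \<eta> \<gamma>) = (\<lambda>\<gamma>. T \<xi> \<gamma> + T \<eta> \<gamma>)"
    and "\<xi> \<in> ell2 A \<Longrightarrow> T (\<lambda>\<gamma>. c * \<xi> \<gamma>) = (\<lambda>\<gamma>. c * T \<xi> \<gamma>)"
    and "\<xi> \<notin> ell2 A \<Longrightarrow> T \<xi> = undefined"
  using assms by (auto simp: bounded_ops_def)

lemma bounded_opsE:
  assumes "T \<in> bounded_ops A"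
  obtains K where "0 \<le> K" "\<And>\<xi>. \<xi> \<in> ell2 A \<Longrightarrow> ell2_norm A (T \<xi>) \<le> K * ell2_norm A \<xi>"
proof -
  obtain K where K: "\<forall>\<xi>\<in>ell2 A. ell2_norm A (T \<xi>) \<le> K * ell2_norm A \<xi>"
    using assms by (auto simp: bounded_ops_def)
  have "ell2_norm A (T \<xi>) \<le> \<bar>K\<bar> * ell2_norm A \<xi>" if "\<xi> \<in> ell2 A" for \<xi>
    using K that ell2_norm_nonneg[of A \<xi>] by (smt (verit, best) mult_right_mono)
  then show ?thesis using that[of "\<bar>K\<bar>"] by simp
qed

lemma zero_in_ell2: "(\<lambda>\<gamma>. 0) \<in> ell2 A"
  by (simp add: ell2_def)

lemma bounded_ops_zero:
  assumes "T \<in> bounded_ops A"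
  shows "T (\<lambda>\<gamma>. 0) = (\<lambda>\<gamma>. 0)"
  using bounded_opsD(3)[OF assms zero_in_ell2, of 0] by simp

lemma has_matrix_finite_support:
  assumes T: "has_matrix A T k" and "finite P" "P \<subseteq> A" "\<alpha> \<in> A"
  shows "T (\<lambda>\<gamma>. if \<gamma> \<in> P then \<xi> \<gamma> else 0) \<alpha> = (\<Sum>\<gamma>\<in>P. k \<alpha> \<gamma> * \<xi> \<gamma>)"
  using assms(2,3)
proof (induction P)
  case empty
  then show ?case using T bounded_ops_zero[of T A] by (simp add: has_matrix_def)
next
  case (insert p P)
  have T': "T \<in> bounded_ops A" using T by (simp add: has_matrix_def)
  have p: "delta p \<in> ell2 A" using insert.prems by (simp add: delta_in_ell2)
  have "(\<lambda>\<gamma>. if \<gamma> \<in> insert p P then \<xi> \<gamma> else 0)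
      = (\<lambda>\<gamma>. \<xi> p * delta p \<gamma> + (if \<gamma> \<in> P then \<xi> \<gamma> else 0))"
    using insert.hyps by (auto simp: delta_def)
  then have "T (\<lambda>\<gamma>. if \<gamma> \<in> insert p P then \<xi> \<gamma> else 0)
      = (\<lambda>\<alpha>. T (\<lambda>\<gamma>. \<xi> p * delta p \<gamma>) \<alpha> + T (\<lambda>\<gamma>. if \<gamma> \<in> P then \<xi> \<gamma> else 0) \<alpha>)"
    using insert bounded_opsD(2)[OF T' ell2_scale[OF p, of "\<xi> p"] ell2_finite_support(1)[of P A \<xi>]]
    by simp
  also have "T (\<lambda>\<gamma>. \<xi> p * delta p \<gamma>) = (\<lambda>\<alpha>. \<xi> p * T (delta p) \<alpha>)"
    by (rule bounded_opsD(3)[OF T' p])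
  finally show ?case
    using insert T \<open>\<alpha> \<in> A\<close> by (simp add: has_matrix_def mult.commute)
qed

text \<open>
  By continuity of \<open>T\<close>, the matrix acts by row sums on all of \<open>l\<^sup>2\<close>: for a finitely supported vector this
  is linearity, and the error of truncating \<open>\<xi>\<close> is at most \<open>K\<close> times the norm of the tail.
\<close>

lemma has_matrix_has_sum:
  assumes T: "has_matrix A T k" and \<xi>: "\<xi> \<in> ell2 A" and \<alpha>: "\<alpha> \<in> A"
  shows "((\<lambda>\<gamma>. k \<alpha> \<gamma> * \<xi> \<gamma>) has_sum T \<xi> \<alpha>) A"
proof -
  have T': "T \<in> bounded_ops A" using T by (simp add: has_matrix_def)
  then obtain K where K: "\<And>\<eta>. \<eta> \<in> ell2 A \<Longrightarrow> ell2_norm A (T \<eta>) \<le> K * ell2_norm A \<eta>"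
    by (rule bounded_opsE) blast
  let ?tail = "\<lambda>P \<gamma>. if \<gamma> \<in> P then 0 else \<xi> \<gamma>"
  have *: "norm ((\<Sum>\<gamma>\<in>P. k \<alpha> \<gamma> * \<xi> \<gamma>) - T \<xi> \<alpha>) \<le> K * ell2_norm A (?tail P)"
    if P: "finite P" "P \<subseteq> A" for P
  proof -
    let ?head = "\<lambda>\<gamma>. if \<gamma> \<in> P then \<xi> \<gamma> else 0"
    have h: "?head \<in> ell2 A" by (rule ell2_finite_support(1)[OF P])
    have t: "?tail P \<in> ell2 A"
      using ell2_add[OF \<xi> ell2_scale[OF h, of "-1"]]
      by (rule back_subst[of "\<lambda>f. f \<in> ell2 A"]) auto
    have "\<xi> = (\<lambda>\<gamma>. ?head \<gamma> + ?tail P \<gamma>)" by auto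
    then have "T \<xi> \<alpha> = T ?head \<alpha> + T (?tail P) \<alpha>"
      using bounded_opsD(2)[OF T' h t] by (metis (no_types, lifting))
    then have "norm ((\<Sum>\<gamma>\<in>P. k \<alpha> \<gamma> * \<xi> \<gamma>) - T \<xi> \<alpha>) = cmod (T (?tail P) \<alpha>)"
      using has_matrix_finite_support[OF T P \<alpha>, of \<xi>] by (simp add: norm_minus_commute)
    also have "\<dots> \<le> ell2_norm A (T (?tail P))"
      by (rule ell2_point_le[OF bounded_opsD(1)[OF T' t]])
    also have "\<dots> \<le> K * ell2_norm A (?tail P)" by (rule K[OF t])
    finally show ?thesis .
  qed
  have "((\<lambda>P. K * ell2_norm A (?tail P)) \<longlongrightarrow> K * 0) (finite_subsets_at_top A)"
    by (rule tendsto_mult[OF tendsto_const ell2_tail_tendsto_0[OF \<xi>]])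
  then have "((\<lambda>P. (\<Sum>\<gamma>\<in>P. k \<alpha> \<gamma> * \<xi> \<gamma>) - T \<xi> \<alpha>) \<longlongrightarrow> 0) (finite_subsets_at_top A)"
    by (rule Lim_null_comparison[rotated, OF tendsto_eq_rhs])
      (auto intro!: eventually_finite_subsets_at_top_weakI *)
  then show ?thesis unfolding has_sum_def by (rule LIM_zero_cancel)
qed

lemma has_matrix_unique:
  assumes "has_matrix A T k" "has_matrix A T' k"
  shows "T = T'"
proof (rule ext)
  fix \<xi>
  have b: "T \<in> bounded_ops A" "T' \<in> bounded_ops A" using assms by (auto simp: has_matrix_def)
  show "T \<xi> = T' \<xi>"
  proof (cases "\<xi> \<in> ell2 A")
    case True
    show ?thesis
    proof (rule ext)
      fix \<alpha>
      show "T \<xi> \<alpha> = T' \<xi> \<alpha>"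
      proof (cases "\<alpha> \<in> A")
        case True': True
        show ?thesis
          using has_matrix_has_sum[OF assms(1) True True'] has_matrix_has_sum[OF assms(2) True True']
          by (rule has_sum_unique)
      next
        case False
        then show ?thesis
          using bounded_opsD(1)[OF b(1) True] bounded_opsD(1)[OF b(2) True] by (simp add: ell2_def)
      qed
    qed
  qed (use b in \<open>simp add: bounded_opsD(4)\<close>)
qed

lemma sections_bounded_norm_le:
  assumes sb: "sections_bounded A k C" and C: "0 \<le> C" and \<xi>: "\<xi> \<in> ell2 A"
    and sums: "\<And>\<alpha>. \<alpha> \<in> A \<Longrightarrow> ((\<lambda>\<gamma>. k \<alpha> \<gamma> * \<xi> \<gamma>) has_sum \<eta> \<alpha>) A"
    and vanish: "\<And>\<alpha>. \<alpha> \<notin> A \<Longrightarrow> \<eta> \<alpha> = 0"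
  shows "\<eta> \<in> ell2 A" and "ell2_norm A \<eta> \<le> C * ell2_norm A \<xi>"
proof -
  have *: "(\<Sum>\<alpha>\<in>Q. (cmod (\<eta> \<alpha>))\<^sup>2) \<le> (C * ell2_norm A \<xi>)\<^sup>2" if Q: "finite Q" "Q \<subseteq> A" for Q
  proof (rule tendsto_upperbound[OF _ _ finite_subsets_at_top_neq_bot])
    show "((\<lambda>P. \<Sum>\<alpha>\<in>Q. (cmod (\<Sum>\<gamma>\<in>P. k \<alpha> \<gamma> * \<xi> \<gamma>))\<^sup>2) \<longlongrightarrow> (\<Sum>\<alpha>\<in>Q. (cmod (\<eta> \<alpha>))\<^sup>2))
        (finite_subsets_at_top A)"
      using sums Q by (intro tendsto_sum tendsto_power tendsto_norm) (auto simp: has_sum_def)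
    show "\<forall>\<^sub>F P in finite_subsets_at_top A.
        (\<Sum>\<alpha>\<in>Q. (cmod (\<Sum>\<gamma>\<in>P. k \<alpha> \<gamma> * \<xi> \<gamma>))\<^sup>2) \<le> (C * ell2_norm A \<xi>)\<^sup>2"
    proof (rule eventually_finite_subsets_at_top_weakI)
      fix P assume P: "finite P" "P \<subseteq> A"
      have "(\<Sum>\<alpha>\<in>Q. (cmod (\<Sum>\<gamma>\<in>P. k \<alpha> \<gamma> * \<xi> \<gamma>))\<^sup>2) \<le> C\<^sup>2 * (\<Sum>\<gamma>\<in>P. (cmod (\<xi> \<gamma>))\<^sup>2)"
        by (rule sections_boundedD[OF sb P(1) Q(1) P(2) Q(2)])
      also have "\<dots> \<le> C\<^sup>2 * (ell2_norm A \<xi>)\<^sup>2"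
        by (intro mult_left_mono ell2_finite_sum_le \<xi> P) simp
      finally show "(\<Sum>\<alpha>\<in>Q. (cmod (\<Sum>\<gamma>\<in>P. k \<alpha> \<gamma> * \<xi> \<gamma>))\<^sup>2) \<le> (C * ell2_norm A \<xi>)\<^sup>2"
        by (simp add: power_mult_distrib)
    qed
  qed
  show "\<eta> \<in> ell2 A" using vanish * by (rule ell2_bounded_sums(1))
  have "(ell2_norm A \<eta>)\<^sup>2 \<le> (C * ell2_norm A \<xi>)\<^sup>2" using vanish * by (rule ell2_bounded_sums(2))
  then show "ell2_norm A \<eta> \<le> C * ell2_norm A \<xi>"
    by (rule power2_le_imp_le) (simp add: C ell2_norm_nonneg)
qed

text \<open>
  Multiplying \<open>\<xi>\<close> by suitable phases makes all terms of a row sum nonnegative without changing the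
  norm of \<open>\<xi>\<close>; the bound for one-row sections then becomes a bound for sums of absolute values.
\<close>

lemma sections_bounded_row_summable:
  assumes sb: "sections_bounded A k C" and \<xi>: "\<xi> \<in> ell2 A" and \<alpha>: "\<alpha> \<in> A"
  shows "(\<lambda>\<gamma>. k \<alpha> \<gamma> * \<xi> \<gamma>) summable_on A"
proof (rule abs_summable_summable, unfold abs_summable_iff_bdd_above)
  have bound: "(\<Sum>\<gamma>\<in>P. cmod (k \<alpha> \<gamma> * \<xi> \<gamma>)) \<le> \<bar>C\<bar> * ell2_norm A \<xi>" if P: "finite P" "P \<subseteq> A" for P
  proof -
    \<comment> \<open>The phase that turns the \<open>\<gamma>\<close>-th term of the row sum into its absolute value.\<close>
    define u where "u \<gamma> = (if k \<alpha> \<gamma> * \<xi> \<gamma> = 0 then 1 else cnj (sgn (k \<alpha> \<gamma> * \<xi> \<gamma>)))" for \<gamma>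
    have u: "cmod (u \<gamma>) = 1" "k \<alpha> \<gamma> * \<xi> \<gamma> * u \<gamma> = of_real (cmod (k \<alpha> \<gamma> * \<xi> \<gamma>))" for \<gamma>
    proof -
      show "cmod (u \<gamma>) = 1" by (simp add: u_def norm_sgn)
      have "w * cnj (sgn w) = of_real (cmod w)" for w :: complex
      proof (cases "w = 0")
        case False
        have "w * cnj (sgn w) = inverse (complex_of_real (cmod w)) * (w * cnj w)"
          by (simp add: sgn_div_norm scaleR_conv_of_real)
        also have "\<dots> = of_real (cmod w)"
          using False by (simp add: power2_eq_square flip: complex_norm_square)
        finally show ?thesis .
      qed simp
      then show "k \<alpha> \<gamma> * \<xi> \<gamma> * u \<gamma> = of_real (cmod (k \<alpha> \<gamma> * \<xi> \<gamma>))" by (simp add: u_def)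
    qed
    have eq: "(\<Sum>\<gamma>\<in>P. k \<alpha> \<gamma> * (\<xi> \<gamma> * u \<gamma>)) = of_real (\<Sum>\<gamma>\<in>P. cmod (k \<alpha> \<gamma> * \<xi> \<gamma>))"
      by (simp add: u flip: mult.assoc)
    have "(\<Sum>\<gamma>\<in>P. cmod (k \<alpha> \<gamma> * \<xi> \<gamma>))\<^sup>2 \<le> C\<^sup>2 * (\<Sum>\<gamma>\<in>P. (cmod (\<xi> \<gamma> * u \<gamma>))\<^sup>2)"
      using sections_boundedD[OF sb P(1) _ P(2), of "{\<alpha>}" "\<lambda>\<gamma>. \<xi> \<gamma> * u \<gamma>"] \<alpha>
      by (simp add: eq del: of_real_sum)
    also have "\<dots> = C\<^sup>2 * (\<Sum>\<gamma>\<in>P. (cmod (\<xi> \<gamma>))\<^sup>2)" by (simp add: norm_mult u)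
    also have "\<dots> \<le> C\<^sup>2 * (ell2_norm A \<xi>)\<^sup>2"
      by (intro mult_left_mono ell2_finite_sum_le \<xi> P) simp
    also have "\<dots> = (\<bar>C\<bar> * ell2_norm A \<xi>)\<^sup>2" by (simp add: power_mult_distrib)
    finally show ?thesis by (rule power2_le_imp_le) (simp add: ell2_norm_nonneg)
  qed
  show "bdd_above (sum (\<lambda>\<gamma>. cmod (k \<alpha> \<gamma> * \<xi> \<gamma>)) ` {F. F \<subseteq> A \<and> finite F})"
    by (rule bdd_aboveI2[where M = "\<bar>C\<bar> * ell2_norm A \<xi>"]) (use bound in auto)
qed

lemma sections_bounded_has_matrix:
  assumes sb: "sections_bounded A k C" and C: "0 \<le> C"
  obtains T where "has_matrix A T k"
proof -
  define R where "R \<xi> \<alpha> = (if \<alpha> \<in> A then \<Sum>\<^sub>\<infinity>\<gamma>\<in>A. k \<alpha> \<gamma> * \<xi> \<gamma> else 0)" for \<xi> \<alpha>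
  define T where "T = restrict R (ell2 A)"
  have sums: "((\<lambda>\<gamma>. k \<alpha> \<gamma> * \<xi> \<gamma>) has_sum R \<xi> \<alpha>) A" if "\<xi> \<in> ell2 A" "\<alpha> \<in> A" for \<xi> \<alpha>
    using sections_bounded_row_summable[OF sb that] that(2) by (simp add: R_def)
  have R: "R \<xi> \<in> ell2 A" "ell2_norm A (R \<xi>) \<le> C * ell2_norm A \<xi>" if "\<xi> \<in> ell2 A" for \<xi>
    using sections_bounded_norm_le[OF sb C that, of "R \<xi>"] sums[OF that] by (simp_all add: R_def)
  have add: "R (\<lambda>\<gamma>. \<xi> \<gamma> + \<eta> \<gamma>) \<alpha> = R \<xi> \<alpha> + R \<eta> \<alpha>" if "\<xi> \<in> ell2 A" "\<eta> \<in> ell2 A" for \<xi> \<eta> \<alpha>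
  proof (cases "\<alpha> \<in> A")
    case True
    show ?thesis
      using sums[OF ell2_add[OF that] True] has_sum_add[OF sums[OF that(1) True] sums[OF that(2) True]]
      by (simp add: distrib_left has_sum_unique)
  qed (simp add: R_def)
  have scale: "R (\<lambda>\<gamma>. c * \<xi> \<gamma>) \<alpha> = c * R \<xi> \<alpha>" for c \<xi> \<alpha>
    by (simp add: R_def mult.left_commute[of _ c] infsum_cmult_right')
  have "T \<in> bounded_ops A"
    unfolding bounded_ops_def T_def using R
    by (auto simp: add scale ell2_add ell2_scale fun_eq_iff)
  moreover have "T (delta \<gamma>) = (\<lambda>\<alpha>. if \<alpha> \<in> A then k \<alpha> \<gamma> else 0)" if "\<gamma> \<in> A" for \<gamma>
  proof
    fix \<alpha>
    have "((\<lambda>\<gamma>'. k \<alpha> \<gamma>' * delta \<gamma> \<gamma>') has_sum k \<alpha> \<gamma>) A"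
      by (rule has_sum_finite_neutralI[of "{\<gamma>}"]) (use that in \<open>auto simp: delta_def\<close>)
    then show "T (delta \<gamma>) \<alpha> = (if \<alpha> \<in> A then k \<alpha> \<gamma> else 0)"
      using that by (simp add: T_def delta_in_ell2 R_def infsumI)
  qed
  ultimately show ?thesis using that[of T] by (simp add: has_matrix_def)
qed

text \<open>
  The operator norm is the least bound for the finite sections. This reduces all later norm
  comparisons to finite sums.
\<close>

lemma has_matrix_op_norm:
  assumes T: "has_matrix A T k"
  shows op_norm_nonneg: "0 \<le> op_norm A T"
    and op_norm_le_iff: "0 \<le> C \<Longrightarrow> op_norm A T \<le> C \<longleftrightarrow> sections_bounded A k C"
proof -
  have T': "T \<in> bounded_ops A" using T by (simp add: has_matrix_def)
  then obtain K where "0 \<le> K" and K: "\<And>\<xi>. \<xi> \<in> ell2 A \<Longrightarrow> ell2_norm A (T \<xi>) \<le> K * ell2_norm A \<xi>"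
    by (rule bounded_opsE) blast
  let ?S = "{ell2_norm A (T \<xi>) | \<xi>. \<xi> \<in> ell2 A \<and> ell2_norm A \<xi> \<le> 1}"
  have bdd: "bdd_above ?S"
  proof (rule bdd_aboveI)
    fix r assume "r \<in> ?S"
    then show "r \<le> K"
      using K mult_left_le[OF _ \<open>0 \<le> K\<close>] by fastforce
  qed
  have zero: "0 \<in> ?S"
    using bounded_ops_zero[OF T'] zero_in_ell2 by (force simp: ell2_norm_def)
  then show "0 \<le> op_norm A T" unfolding op_norm_def by (rule cSup_upper[OF _ bdd])
  assume C: "0 \<le> C"
  show "op_norm A T \<le> C \<longleftrightarrow> sections_bounded A k C"
  proof
    assume le: "op_norm A T \<le> C"
    have norm_le: "ell2_norm A (T \<xi>) \<le> C * ell2_norm A \<xi>" if \<xi>: "\<xi> \<in> ell2 A" for \<xi>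
    proof (cases "ell2_norm A \<xi> = 0")
      case True
      then show ?thesis using K[OF \<xi>] by simp
    next
      case False
      then have pos: "0 < ell2_norm A \<xi>" using ell2_norm_nonneg[of A \<xi>] by simp
      let ?c = "complex_of_real (inverse (ell2_norm A \<xi>))"
      have c: "cmod ?c = inverse (ell2_norm A \<xi>)"
        using pos by (simp only: norm_of_real) simp
      have "ell2_norm A (\<lambda>\<gamma>. ?c * \<xi> \<gamma>) = 1"
        using pos by (simp only: ell2_norm_scale c) simp
      then have "ell2_norm A (T (\<lambda>\<gamma>. ?c * \<xi> \<gamma>)) \<in> ?S"
        using ell2_scale[OF \<xi>, of ?c] by (intro CollectI exI conjI) auto
      then have "ell2_norm A (T (\<lambda>\<gamma>. ?c * \<xi> \<gamma>)) \<le> C"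
        using cSup_upper[OF _ bdd] le by (force simp: op_norm_def)
      then show ?thesis
        using pos unfolding bounded_opsD(3)[OF T' \<xi>] ell2_norm_scale c
        by (simp add: field_simps)
    qed
    show "sections_bounded A k C"
      unfolding sections_bounded_def
    proof (intro allI impI)
      fix P Q \<xi> assume P: "finite P" and Q: "finite Q" and PA: "P \<subseteq> A" and QA: "Q \<subseteq> A"
      let ?\<xi> = "\<lambda>\<gamma>. if \<gamma> \<in> P then \<xi> \<gamma> else (0 :: complex)"
      have \<xi>: "?\<xi> \<in> ell2 A" by (rule ell2_finite_support(1)[OF P PA])
      have "(\<Sum>\<alpha>\<in>Q. (cmod (\<Sum>\<gamma>\<in>P. k \<alpha> \<gamma> * \<xi> \<gamma>))\<^sup>2) = (\<Sum>\<alpha>\<in>Q. (cmod (T ?\<xi> \<alpha>))\<^sup>2)"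
        by (rule sum.cong[OF refl]) (use has_matrix_finite_support[OF T P PA] QA in auto)
      also have "\<dots> \<le> (ell2_norm A (T ?\<xi>))\<^sup>2"
        by (rule ell2_finite_sum_le[OF bounded_opsD(1)[OF T' \<xi>] Q QA])
      also have "\<dots> \<le> (C * ell2_norm A ?\<xi>)\<^sup>2"
        by (rule power_mono[OF norm_le[OF \<xi>] ell2_norm_nonneg])
      also have "\<dots> = C\<^sup>2 * (\<Sum>\<gamma>\<in>P. (cmod (\<xi> \<gamma>))\<^sup>2)"
        by (simp only: power_mult_distrib ell2_finite_support(2)[OF P PA])
      finally show "(\<Sum>\<alpha>\<in>Q. (cmod (\<Sum>\<gamma>\<in>P. k \<alpha> \<gamma> * \<xi> \<gamma>))\<^sup>2)
          \<le> C\<^sup>2 * (\<Sum>\<gamma>\<in>P. (cmod (\<xi> \<gamma>))\<^sup>2)" .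
    qed
  next
    assume sb: "sections_bounded A k C"
    show "op_norm A T \<le> C"
      unfolding op_norm_def
    proof (rule cSup_least)
      show "?S \<noteq> {}" using zero by blast
      fix r assume "r \<in> ?S"
      then obtain \<xi> where \<xi>: "\<xi> \<in> ell2 A" "ell2_norm A \<xi> \<le> 1" and r: "r = ell2_norm A (T \<xi>)"
        by blast
      have "r \<le> C * ell2_norm A \<xi>"
        unfolding r
      proof (rule sections_bounded_norm_le(2)[OF sb C \<xi>(1)])
        show "((\<lambda>\<gamma>. k \<alpha> \<gamma> * \<xi> \<gamma>) has_sum T \<xi> \<alpha>) A" if "\<alpha> \<in> A" for \<alpha>
          by (rule has_matrix_has_sum[OF T \<xi>(1) that])
        show "T \<xi> \<alpha> = 0" if "\<alpha> \<notin> A" for \<alpha>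
          using bounded_opsD(1)[OF T' \<xi>(1)] that by (simp add: ell2_def)
      qed
      then show "r \<le> C" using mult_left_le[OF \<xi>(2) C] by linarith
    qed
  qed
qed

text \<open>
  The constant is crude (it comes from \<open>|a + b|\<^sup>2 \<le> 2|a|\<^sup>2 + 2|b|\<^sup>2\<close>), but only the existence of some bound
  matters for sums.
\<close>

lemma sections_bounded_add:
  assumes "sections_bounded A k C" "sections_bounded A l D" "0 \<le> C" "0 \<le> D"
  shows "sections_bounded A (\<lambda>\<alpha> \<gamma>. k \<alpha> \<gamma> + l \<alpha> \<gamma>) (2 * (C + D))"
  unfolding sections_bounded_def
proof (intro allI impI)
  fix P Q \<xi> assume P: "finite P" and Q: "finite Q" and PA: "P \<subseteq> A" and QA: "Q \<subseteq> A"
  let ?K = "\<lambda>\<alpha>. \<Sum>\<gamma>\<in>P. k \<alpha> \<gamma> * \<xi> \<gamma>" and ?L = "\<lambda>\<alpha>. \<Sum>\<gamma>\<in>P. l \<alpha> \<gamma> * \<xi> \<gamma>"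
  let ?N = "\<Sum>\<gamma>\<in>P. (cmod (\<xi> \<gamma>))\<^sup>2"
  have "(cmod (a + b))\<^sup>2 \<le> 2 * (cmod a)\<^sup>2 + 2 * (cmod b)\<^sup>2" for a b
  proof -
    have "(cmod (a + b))\<^sup>2 \<le> (cmod a + cmod b)\<^sup>2" by (simp add: norm_triangle_ineq power_mono)
    then show ?thesis using sum_squares_bound[of "cmod a" "cmod b"] by (simp add: power2_sum)
  qed
  then have "(\<Sum>\<alpha>\<in>Q. (cmod (?K \<alpha> + ?L \<alpha>))\<^sup>2)
      \<le> (\<Sum>\<alpha>\<in>Q. 2 * (cmod (?K \<alpha>))\<^sup>2 + 2 * (cmod (?L \<alpha>))\<^sup>2)"
    by (rule sum_mono)
  also have "\<dots> = 2 * (\<Sum>\<alpha>\<in>Q. (cmod (?K \<alpha>))\<^sup>2) + 2 * (\<Sum>\<alpha>\<in>Q. (cmod (?L \<alpha>))\<^sup>2)"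
    by (simp add: sum.distrib sum_distrib_left)
  also have "\<dots> \<le> 2 * (C\<^sup>2 * ?N) + 2 * (D\<^sup>2 * ?N)"
    using sections_boundedD[OF assms(1) P Q PA QA, of \<xi>] sections_boundedD[OF assms(2) P Q PA QA, of \<xi>]
    by linarith
  also have "\<dots> = (2 * C\<^sup>2 + 2 * D\<^sup>2) * ?N" by (simp add: algebra_simps)
  also have "\<dots> \<le> (2 * (C + D))\<^sup>2 * ?N"
    using assms(3,4) by (intro mult_right_mono sum_nonneg) (auto simp: power2_eq_square algebra_simps)
  finally show "(\<Sum>\<alpha>\<in>Q. (cmod (\<Sum>\<gamma>\<in>P. (k \<alpha> \<gamma> + l \<alpha> \<gamma>) * \<xi> \<gamma>))\<^sup>2) \<le> (2 * (C + D))\<^sup>2 * ?N"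
    by (simp add: distrib_right sum.distrib)
qed

lemma sections_bounded_scale:
  assumes "sections_bounded A k C"
  shows "sections_bounded A (\<lambda>\<alpha> \<gamma>. c * k \<alpha> \<gamma>) (cmod c * C)"
  unfolding sections_bounded_def
proof (intro allI impI)
  fix P Q \<xi> assume *: "finite P" "finite Q" "P \<subseteq> A" "Q \<subseteq> A"
  have "(\<Sum>\<alpha>\<in>Q. (cmod (\<Sum>\<gamma>\<in>P. c * k \<alpha> \<gamma> * \<xi> \<gamma>))\<^sup>2)
      = (cmod c)\<^sup>2 * (\<Sum>\<alpha>\<in>Q. (cmod (\<Sum>\<gamma>\<in>P. k \<alpha> \<gamma> * \<xi> \<gamma>))\<^sup>2)"
    by (simp add: mult.assoc norm_mult power_mult_distrib flip: sum_distrib_left)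
  also have "\<dots> \<le> (cmod c)\<^sup>2 * (C\<^sup>2 * (\<Sum>\<gamma>\<in>P. (cmod (\<xi> \<gamma>))\<^sup>2))"
    by (rule mult_left_mono[OF sections_boundedD[OF assms *]]) simp
  finally show "(\<Sum>\<alpha>\<in>Q. (cmod (\<Sum>\<gamma>\<in>P. c * k \<alpha> \<gamma> * \<xi> \<gamma>))\<^sup>2)
      \<le> (cmod c * C)\<^sup>2 * (\<Sum>\<gamma>\<in>P. (cmod (\<xi> \<gamma>))\<^sup>2)"
    by (simp add: power_mult_distrib mult.assoc)
qed

text \<open>
  With at most one nonzero entry in each row and column, the matrix moves coordinates around
  injectively and multiplies each by a scalar of modulus at most \<open>C\<close>.
\<close>

lemma sections_bounded_monomial:
  assumes bound: "\<And>\<alpha> \<gamma>. \<alpha> \<in> A \<Longrightarrow> \<gamma> \<in> A \<Longrightarrow> cmod (k \<alpha> \<gamma>) \<le> C"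
    and row: "\<And>\<alpha> \<gamma> \<gamma>'. \<alpha> \<in> A \<Longrightarrow> \<gamma> \<in> A \<Longrightarrow> \<gamma>' \<in> A \<Longrightarrow> k \<alpha> \<gamma> \<noteq> 0 \<Longrightarrow> k \<alpha> \<gamma>' \<noteq> 0 \<Longrightarrow> \<gamma> = \<gamma>'"
    and col: "\<And>\<alpha> \<alpha>' \<gamma>. \<alpha> \<in> A \<Longrightarrow> \<alpha>' \<in> A \<Longrightarrow> \<gamma> \<in> A \<Longrightarrow> k \<alpha> \<gamma> \<noteq> 0 \<Longrightarrow> k \<alpha>' \<gamma> \<noteq> 0 \<Longrightarrow> \<alpha> = \<alpha>'"
  shows "sections_bounded A k C"
  unfolding sections_bounded_def
proof (intro allI impI)
  fix P Q \<xi> assume P: "finite P" and Q: "finite Q" and PA: "P \<subseteq> A" and QA: "Q \<subseteq> A"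
  have row_sq: "(cmod (\<Sum>\<gamma>\<in>P. k \<alpha> \<gamma> * \<xi> \<gamma>))\<^sup>2 = (\<Sum>\<gamma>\<in>P. (cmod (k \<alpha> \<gamma> * \<xi> \<gamma>))\<^sup>2)"
    if \<alpha>: "\<alpha> \<in> A" for \<alpha>
  proof (cases "\<exists>\<gamma>\<in>P. k \<alpha> \<gamma> \<noteq> 0")
    case True
    then obtain \<delta> where \<delta>: "\<delta> \<in> P" "k \<alpha> \<delta> \<noteq> 0" by blast
    then have z: "k \<alpha> \<gamma> = 0" if "\<gamma> \<in> P - {\<delta>}" for \<gamma> using row[OF \<alpha>, of \<delta> \<gamma>] that PA by blast
    show ?thesis using P \<delta> z by (simp add: sum.remove[of P \<delta>])
  qed simp
  have col_sq: "(\<Sum>\<alpha>\<in>Q. (cmod (k \<alpha> \<gamma> * \<xi> \<gamma>))\<^sup>2) \<le> C\<^sup>2 * (cmod (\<xi> \<gamma>))\<^sup>2" if \<gamma>: "\<gamma> \<in> A" for \<gamma>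
  proof (cases "\<exists>\<alpha>\<in>Q. k \<alpha> \<gamma> \<noteq> 0")
    case True
    then obtain \<delta> where \<delta>: "\<delta> \<in> Q" "k \<delta> \<gamma> \<noteq> 0" by blast
    then have z: "k \<alpha> \<gamma> = 0" if "\<alpha> \<in> Q - {\<delta>}" for \<alpha> using col[OF _ _ \<gamma>, of \<delta> \<alpha>] that QA by blast
    have "(\<Sum>\<alpha>\<in>Q. (cmod (k \<alpha> \<gamma> * \<xi> \<gamma>))\<^sup>2) = (cmod (k \<delta> \<gamma>))\<^sup>2 * (cmod (\<xi> \<gamma>))\<^sup>2"
      using Q \<delta> z by (simp add: sum.remove[of Q \<delta>] norm_mult power_mult_distrib)
    also have "\<dots> \<le> C\<^sup>2 * (cmod (\<xi> \<gamma>))\<^sup>2"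
      using bound[of \<delta> \<gamma>] \<gamma> \<delta> QA by (intro mult_right_mono power_mono) auto
    finally show ?thesis .
  qed simp
  have "(\<Sum>\<alpha>\<in>Q. (cmod (\<Sum>\<gamma>\<in>P. k \<alpha> \<gamma> * \<xi> \<gamma>))\<^sup>2) = (\<Sum>\<alpha>\<in>Q. \<Sum>\<gamma>\<in>P. (cmod (k \<alpha> \<gamma> * \<xi> \<gamma>))\<^sup>2)"
    by (rule sum.cong[OF refl]) (use row_sq QA in blast)
  also have "\<dots> = (\<Sum>\<gamma>\<in>P. \<Sum>\<alpha>\<in>Q. (cmod (k \<alpha> \<gamma> * \<xi> \<gamma>))\<^sup>2)" by (rule sum.swap)
  also have "\<dots> \<le> (\<Sum>\<gamma>\<in>P. C\<^sup>2 * (cmod (\<xi> \<gamma>))\<^sup>2)"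
    by (rule sum_mono) (use col_sq PA in blast)
  finally show "(\<Sum>\<alpha>\<in>Q. (cmod (\<Sum>\<gamma>\<in>P. k \<alpha> \<gamma> * \<xi> \<gamma>))\<^sup>2) \<le> C\<^sup>2 * (\<Sum>\<gamma>\<in>P. (cmod (\<xi> \<gamma>))\<^sup>2)"
    by (simp add: sum_distrib_left)
qed

text \<open>
  Lower semicontinuity of the norm, for matrices over varying index sets. Any finite set of indices
  eventually embeds by \<open>\<phi> i\<close>, so a section of \<open>k\<close> is a limit of sections of the \<open>l i\<close> with the same
  vector \<open>\<xi>\<close>, hence of the same norm.
\<close>

lemma sections_bounded_limit:
  assumes \<Phi>: "\<Phi> \<noteq> bot"
    and sb: "\<forall>\<^sub>F i in \<Phi>. sections_bounded (B i) (l i) C"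
    and inB: "\<And>\<gamma>. \<gamma> \<in> A \<Longrightarrow> \<forall>\<^sub>F i in \<Phi>. \<phi> i \<gamma> \<in> B i"
    and inj: "\<And>\<gamma> \<gamma>'. \<gamma> \<in> A \<Longrightarrow> \<gamma>' \<in> A \<Longrightarrow> \<gamma> \<noteq> \<gamma>' \<Longrightarrow> \<forall>\<^sub>F i in \<Phi>. \<phi> i \<gamma> \<noteq> \<phi> i \<gamma>'"
    and lim: "\<And>\<alpha> \<gamma>. \<alpha> \<in> A \<Longrightarrow> \<gamma> \<in> A \<Longrightarrow> ((\<lambda>i. l i (\<phi> i \<alpha>) (\<phi> i \<gamma>)) \<longlongrightarrow> k \<alpha> \<gamma>) \<Phi>"
  shows "sections_bounded A k C"
  unfolding sections_bounded_def
proof (intro allI impI)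
  fix P Q \<xi> assume P: "finite P" and Q: "finite Q" and PA: "P \<subseteq> A" and QA: "Q \<subseteq> A"
  let ?N = "\<Sum>\<gamma>\<in>P. (cmod (\<xi> \<gamma>))\<^sup>2"
  show "(\<Sum>\<alpha>\<in>Q. (cmod (\<Sum>\<gamma>\<in>P. k \<alpha> \<gamma> * \<xi> \<gamma>))\<^sup>2) \<le> C\<^sup>2 * ?N"
  proof (rule tendsto_upperbound[OF _ _ \<Phi>])
    show "((\<lambda>i. \<Sum>\<alpha>\<in>Q. (cmod (\<Sum>\<gamma>\<in>P. l i (\<phi> i \<alpha>) (\<phi> i \<gamma>) * \<xi> \<gamma>))\<^sup>2) \<longlongrightarrow>
        (\<Sum>\<alpha>\<in>Q. (cmod (\<Sum>\<gamma>\<in>P. k \<alpha> \<gamma> * \<xi> \<gamma>))\<^sup>2)) \<Phi>"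
      using lim PA QA by (intro tendsto_sum tendsto_power tendsto_norm tendsto_mult tendsto_const) auto
    have fin: "finite (P \<union> Q)" using P Q by simp
    have "\<forall>\<^sub>F i in \<Phi>. \<forall>\<gamma>\<in>P \<union> Q. \<phi> i \<gamma> \<in> B i"
      by (rule eventually_ball_finite[OF fin]) (use inB PA QA in blast)
    moreover have "\<forall>\<^sub>F i in \<Phi>. \<forall>\<gamma>\<in>P \<union> Q. \<forall>\<gamma>'\<in>P \<union> Q. \<gamma> \<noteq> \<gamma>' \<longrightarrow> \<phi> i \<gamma> \<noteq> \<phi> i \<gamma>'"
    proof (intro eventually_ball_finite[OF fin] ballI)
      show "\<forall>\<^sub>F i in \<Phi>. \<gamma> \<noteq> \<gamma>' \<longrightarrow> \<phi> i \<gamma> \<noteq> \<phi> i \<gamma>'" if "\<gamma> \<in> P \<union> Q" "\<gamma>' \<in> P \<union> Q" for \<gamma> \<gamma>'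
        using inj[of \<gamma> \<gamma>'] that PA QA by (cases "\<gamma> = \<gamma>'") auto
    qed
    ultimately show "\<forall>\<^sub>F i in \<Phi>. (\<Sum>\<alpha>\<in>Q. (cmod (\<Sum>\<gamma>\<in>P. l i (\<phi> i \<alpha>) (\<phi> i \<gamma>) * \<xi> \<gamma>))\<^sup>2) \<le> C\<^sup>2 * ?N"
      using sb
    proof eventually_elim
      case (elim i)
      then have injP: "inj_on (\<phi> i) P" and injQ: "inj_on (\<phi> i) Q"
        unfolding inj_on_def by blast+
      \<comment> \<open>The vector \<open>\<xi>\<close> transported along the injection \<open>\<phi> i\<close>.\<close>
      define \<eta> where "\<eta> = \<xi> \<circ> inv_into P (\<phi> i)"
      have \<eta>: "\<eta> (\<phi> i \<gamma>) = \<xi> \<gamma>" if "\<gamma> \<in> P" for \<gamma> using that injP by (simp add: \<eta>_def)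
      have "(\<Sum>\<alpha>\<in>\<phi> i ` Q. (cmod (\<Sum>\<gamma>\<in>\<phi> i ` P. l i \<alpha> \<gamma> * \<eta> \<gamma>))\<^sup>2)
          \<le> C\<^sup>2 * (\<Sum>\<gamma>\<in>\<phi> i ` P. (cmod (\<eta> \<gamma>))\<^sup>2)"
        by (rule sections_boundedD[OF elim(3)]) (use P Q elim(1) in auto)
      then show ?case by (simp add: sum.reindex injP injQ \<eta>)
    qed
  qed
qed

section \<open>Inverse semigroups\<close>

lemma star_props: "s * star s * s = s" "star s * s * star s = star s"
  for s :: "'s::inverse_semigroup"
  using theI'[OF ex1_star[of s]] by (auto simp: star_def)

lemma star_unique:
  fixes s t :: "'s::inverse_semigroup"
  assumes "s * t * s = s" "t * s * t = t"
  shows "star s = t"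
  unfolding star_def by (rule the1_equality[OF ex1_star]) (use assms in simp)

lemma star_star [simp]: "star (star s) = s" for s :: "'s::inverse_semigroup"
  by (rule star_unique) (simp_all add: star_props)

lemma idemsD: "e \<in> idems \<Longrightarrow> e * e = e"
  by (simp add: idems_def)

lemma star_idem [simp]: "e \<in> idems \<Longrightarrow> star e = e"
  by (rule star_unique) (simp_all add: idems_def)

lemma star_mult_idems [simp]: "star s * s \<in> idems" "s * star s \<in> idems"
  for s :: "'s::inverse_semigroup"
  by (simp_all add: idems_def star_props flip: mult.assoc)

text \<open>
  If \<open>x\<close> is the inverse of \<open>ef\<close>, then \<open>fxe\<close> is an inverse of \<open>ef\<close> too, so \<open>x = fxe\<close> by uniqueness. Such an
  \<open>x\<close> is idempotent, hence is its own inverse, which gives \<open>ef = x\<close>.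
\<close>

lemma idems_mult [simp]:
  fixes e f :: "'s::inverse_semigroup"
  assumes e: "e \<in> idems" and f: "f \<in> idems"
  shows "e * f \<in> idems"
proof -
  define x where "x = star (e * f)"
  have ee: "e * (e * y) = e * y" and ff: "f * (f * y) = f * y" for y
    using e f by (simp_all add: idemsD flip: mult.assoc)
  have x: "e * (f * (x * (e * f))) = e * f" "x * (e * (f * x)) = x"
    using star_props[of "e * f"] by (simp_all add: x_def mult.assoc)
  have x': "x * (e * (f * (x * y))) = x * y" for y
    using x(2) by (metis mult.assoc)
  have "star (e * f) = f * x * e"
    by (rule star_unique) (simp_all add: mult.assoc ee ff x x')
  then have fxe: "f * (x * e) = x" by (simp add: x_def mult.assoc)
  have "x * x = x"
  proof -
    have "x * x = f * (x * e) * (f * (x * e))" by (simp add: fxe)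
    also have "\<dots> = f * (x * e)" by (simp add: mult.assoc x')
    finally show ?thesis by (simp add: fxe)
  qed
  then have x_idem: "x \<in> idems" by (simp add: idems_def)
  then have "star x = x" by simp
  then show ?thesis using x_idem by (simp add: x_def)
qed

text \<open>
  Both \<open>ef\<close> and \<open>fe\<close> are inverses of \<open>ef\<close>.
\<close>

lemma idems_commute:
  fixes e f :: "'s::inverse_semigroup"
  assumes e: "e \<in> idems" and f: "f \<in> idems"
  shows "e * f = f * e"
proof -
  have ee: "e * (e * y) = e * y" and ff: "f * (f * y) = f * y" for y
    using e f by (simp_all add: idemsD flip: mult.assoc)
  have ef: "e * (f * (e * f)) = e * f" and fe: "f * (e * (f * e)) = f * e"
    using idemsD[OF idems_mult[OF e f]] idemsD[OF idems_mult[OF f e]] by (simp_all add: mult.assoc)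
  have "star (e * f) = f * e"
    by (rule star_unique) (simp_all add: mult.assoc ee ff ef fe)
  then show ?thesis using e f by simp
qed

lemma star_mult: "star (s * t) = star t * star s" for s t :: "'s::inverse_semigroup"
proof (rule star_unique)
  have c: "(t * star t) * (star s * s) = (star s * s) * (t * star t)"
    by (rule idems_commute) simp_all
  have "s * t * (star t * star s) * (s * t) = s * ((t * star t) * (star s * s)) * t"
    by (simp add: mult.assoc)
  also have "\<dots> = (s * star s * s) * (t * star t * t)" by (simp add: c) (simp add: mult.assoc)
  finally show "s * t * (star t * star s) * (s * t) = s * t" by (simp add: star_props)
  have "star t * star s * (s * t) * (star t * star s) = star t * ((star s * s) * (t * star t)) * star s"
    by (simp add: mult.assoc)
  also have "\<dots> = (star t * t * star t) * (star s * s * star s)"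
    by (simp add: c[symmetric]) (simp add: mult.assoc)
  finally show "star t * star s * (s * t) * (star t * star s) = star t * star s"
    by (simp add: star_props)
qed

lemma idem_left_commute:
  fixes e f x :: "'s::inverse_semigroup"
  assumes "e \<in> idems" "f \<in> idems"
  shows "e * (f * x) = f * (e * x)"
  using idems_commute[OF assms] by (simp flip: mult.assoc)

lemma conj_idems [simp]:
  fixes s e :: "'s::inverse_semigroup"
  assumes "e \<in> idems"
  shows "star s * e * s \<in> idems"
proof -
  have "star s * e * s = star (e * s) * (e * s)"
    using assms by (simp add: star_mult mult.assoc) (simp add: idemsD flip: mult.assoc)
  then show ?thesis by simp
qed

lemma source_idem_mult:
  fixes s e :: "'s::inverse_semigroup"
  assumes "e \<in> idems"
  shows "star (e * s) * (e * s) = star s * e * s"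
  using assms by (simp add: star_mult mult.assoc) (simp add: idemsD flip: mult.assoc)

lemma source_mult: "star (s * t) * (s * t) = star t * (star s * s) * t"
  for s t :: "'s::inverse_semigroup"
  by (simp add: star_mult mult.assoc)

lemma idem_conj:
  fixes s e :: "'s::inverse_semigroup"
  assumes "e \<in> idems"
  shows "e * s = s * (star s * e * s)"
proof -
  have "s * (star s * e * s) = ((s * star s) * e) * s" by (simp add: mult.assoc)
  also have "\<dots> = e * (s * star s) * s" using assms by (simp add: idems_commute)
  also have "\<dots> = e * s" by (simp add: mult.assoc) (simp add: star_props flip: mult.assoc)
  finally show ?thesis by simp
qed

lemma nat_le_idem_iff:
  fixes e f :: "'s::inverse_semigroup"
  assumes "e \<in> idems"
  shows "nat_le e f \<longleftrightarrow> f * e = e"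
  using assms by (simp add: nat_le_def mult.assoc idemsD)

section \<open>Germs of an action\<close>

text \<open>
  The part of the definition of an action that the algebra of germs and the topology of arrows rest on.
  It is satisfied both by the given action on \<open>X\<close> and by the induced one on \<open>X\<^sup>K\<^sup>S\<close>.
\<close>

locale partial_action =
  fixes Z :: "'z topology" and \<theta> :: "'s::inverse_semigroup \<Rightarrow> 'z \<rightharpoonup> 'z"
  assumes dom_subset: "dom (\<theta> s) \<subseteq> topspace Z"
    and inj_act: "inj_on (\<theta> s) (dom (\<theta> s))"
    and act_mult: "\<theta> (s * t) = \<theta> s \<circ>\<^sub>m \<theta> t"
    and open_act_dom: "e \<in> idems \<Longrightarrow> openin Z (act_dom \<theta> e)"

sublocale inverse_semigroup_action \<subseteq> partial_action X \<theta>
  using dom_subset inj_act act_mult open_act_dom by unfold_locales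

context partial_action
begin

abbreviation source :: "'s \<Rightarrow> 'z set" where
  "source s \<equiv> act_dom \<theta> (star s * s)"

abbreviation G :: "(('s \<times> 'z) set, 'z) top_groupoid" where
  "G \<equiv> transformation_groupoid Z \<theta>"

lemma act_mult_Some:
  "\<theta> (s * t) z = Some w \<longleftrightarrow> (\<exists>y. \<theta> t z = Some y \<and> \<theta> s y = Some w)"
  by (simp add: act_mult map_comp_def split: option.split)

lemma act_inj: "\<theta> s z = Some w \<Longrightarrow> \<theta> s z' = Some w \<Longrightarrow> z = z'"
  using inj_act[of s] by (auto simp: inj_on_def dom_def)

lemma act_idem:
  assumes "e \<in> idems" "\<theta> e z = Some w"
  shows "w = z"
  using assms act_mult_Some[of e e z w] act_inj by (fastforce simp: idemsD)

lemma mem_act_dom: "z \<in> act_dom \<theta> e \<longleftrightarrow> \<theta> e z = Some z"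
  by (simp add: act_dom_def)

lemma act_star:
  assumes "\<theta> s z = Some w"
  shows "\<theta> (star s) w = Some z"
proof -
  have "\<theta> (s * (star s * s)) z = Some w"
    using assms by (simp add: star_props flip: mult.assoc)
  then obtain y where y: "\<theta> (star s * s) z = Some y" "\<theta> s y = Some w"
    by (auto simp: act_mult_Some)
  then show ?thesis using assms by (metis act_mult_Some act_inj option.inject)
qed

lemma mem_source: "z \<in> source s \<longleftrightarrow> (\<exists>w. \<theta> s z = Some w)"
proof
  assume "\<exists>w. \<theta> s z = Some w"
  then show "z \<in> source s" using act_star by (auto simp: mem_act_dom act_mult_Some)
qed (auto simp: mem_act_dom act_mult_Some)

lemma act_dom_mult:
  assumes "e \<in> idems" "f \<in> idems"
  shows "act_dom \<theta> (e * f) = act_dom \<theta> e \<inter> act_dom \<theta> f"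
  using act_idem[OF assms(2)] act_idem[OF assms(1)]
  by (fastforce simp: mem_act_dom act_mult_Some)

lemma act_dom_conj:
  assumes "\<theta> s z = Some w" "e \<in> idems"
  shows "z \<in> act_dom \<theta> (star s * e * s) \<longleftrightarrow> w \<in> act_dom \<theta> e"
proof
  assume "w \<in> act_dom \<theta> e"
  then show "z \<in> act_dom \<theta> (star s * e * s)"
    using assms act_star by (simp add: mem_act_dom act_mult_Some)
next
  assume "z \<in> act_dom \<theta> (star s * e * s)"
  then obtain y where "\<theta> e w = Some y" using assms by (auto simp: mem_act_dom act_mult_Some)
  then show "w \<in> act_dom \<theta> e" using act_idem[OF assms(2)] by (simp add: mem_act_dom)
qed

lemma source_mult_iff:
  assumes "\<theta> t z = Some w"
  shows "z \<in> source (s * t) \<longleftrightarrow> w \<in> source s"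
  using assms by (simp only: mem_source) (auto simp: act_mult_Some)

lemma source_subset: "source s \<subseteq> topspace Z"
  using openin_subset[OF open_act_dom] by simp

lemma mem_germ:
  "(t, w) \<in> germ \<theta> s z \<longleftrightarrow> w = z \<and> z \<in> source s \<and> z \<in> source t \<and>
     (\<exists>e\<in>idems. s * e = t * e \<and> z \<in> act_dom \<theta> e)"
  by (auto simp: germ_def germ_rel_def)

lemma germ_self: "z \<in> source s \<Longrightarrow> (s, z) \<in> germ \<theta> s z"
  unfolding mem_germ by (auto intro: star_mult_idems)

text \<open>
  Transitivity is the point here: witnesses \<open>e\<close> and \<open>f\<close> for two equalities combine to the witness
  \<open>ef\<close>, because idempotents commute.
\<close>

lemma germ_eq_iff:
  assumes "z \<in> source s" "z \<in> source t"
  shows "germ \<theta> s z = germ \<theta> t z \<longleftrightarrow> (\<exists>e\<in>idems. s * e = t * e \<and> z \<in> act_dom \<theta> e)"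
proof
  assume "germ \<theta> s z = germ \<theta> t z"
  then show "\<exists>e\<in>idems. s * e = t * e \<and> z \<in> act_dom \<theta> e"
    using germ_self[OF assms(2)] mem_germ by blast
next
  assume "\<exists>e\<in>idems. s * e = t * e \<and> z \<in> act_dom \<theta> e"
  then obtain e where e: "e \<in> idems" "s * e = t * e" "z \<in> act_dom \<theta> e" by blast
  have *: "germ \<theta> p z \<subseteq> germ \<theta> q z" if pq: "z \<in> source q" "p * e = q * e" for p q
  proof (rule subrelI)
    fix u w assume "(u, w) \<in> germ \<theta> p z"
    then obtain f where f: "w = z" "z \<in> source u" "f \<in> idems" "p * f = u * f" "z \<in> act_dom \<theta> f"
      by (auto simp: mem_germ)
    have "q * (e * f) = p * (e * f)" using pq(2) by (metis mult.assoc)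
    also have "\<dots> = p * (f * e)" using e(1) f(3) by (simp add: idems_commute)
    also have "\<dots> = u * (f * e)" using f(4) by (metis mult.assoc)
    also have "\<dots> = u * (e * f)" using e(1) f(3) by (simp add: idems_commute)
    finally show "(u, w) \<in> germ \<theta> q z"
      using pq e f unfolding mem_germ by (auto simp: act_dom_mult intro!: bexI[of _ "e * f"])
  qed
  show "germ \<theta> s z = germ \<theta> t z" using *[of t s] *[of s t] assms e by auto
qed

lemma mem_germ_eq: "(t, w) \<in> germ \<theta> s z \<Longrightarrow> w = z \<and> z \<in> source t \<and> germ \<theta> t z = germ \<theta> s z"
  using germ_eq_iff mem_germ by metis

lemma germ_inj:
  assumes "z \<in> source s" "germ \<theta> s z = germ \<theta> t w"
  shows "z = w"
  using germ_self[OF assms(1)] assms(2) mem_germ_eq by metis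

lemma germ_eq_act:
  assumes "z \<in> source s" "z \<in> source t" "germ \<theta> s z = germ \<theta> t z"
  shows "\<theta> s z = \<theta> t z"
proof -
  obtain e where e: "s * e = t * e" "\<theta> e z = Some z"
    using assms germ_eq_iff by (auto simp: mem_act_dom)
  have "\<theta> (s * e) z = \<theta> (t * e) z" by (simp add: e)
  then show ?thesis by (simp add: act_mult map_comp_def e(2))
qed

lemma src_germ: "z \<in> source s \<Longrightarrow> src G (germ \<theta> s z) = z"
  unfolding transformation_groupoid_def
  by (auto intro!: the_equality dest: germ_self mem_germ_eq)

lemma tgt_germ:
  assumes "\<theta> s z = Some w"
  shows "tgt G (germ \<theta> s z) = w"
proof -
  have z: "z \<in> source s" using assms mem_source by blast
  have "(THE w. \<exists>t y. (t, y) \<in> germ \<theta> s z \<and> \<theta> t y = Some w) = w"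
  proof (rule the_equality)
    show "\<exists>t y. (t, y) \<in> germ \<theta> s z \<and> \<theta> t y = Some w" using germ_self[OF z] assms by blast
    show "w' = w" if "\<exists>t y. (t, y) \<in> germ \<theta> s z \<and> \<theta> t y = Some w'" for w'
      using that mem_germ_eq germ_eq_act z assms by (metis option.inject)
  qed
  then show ?thesis by (simp add: transformation_groupoid_def)
qed

text \<open>
  Independence of representatives: if \<open>e\<close> witnesses \<open>[s, w] = [s', w]\<close> and \<open>f\<close> witnesses \<open>[t, z] = [t', z]\<close>, then
  \<open>(t\<^sup>*et)f\<close> witnesses \<open>[st, z] = [s't', z]\<close>, as \<open>t(t\<^sup>*et) = et\<close>.
\<close>

lemma gmult_germ:
  assumes t: "\<theta> t z = Some w" and s: "w \<in> source s"
  shows "gmult G (germ \<theta> s w) (germ \<theta> t z) = germ \<theta> (s * t) z"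
proof -
  have z: "z \<in> source t" using t mem_source by blast
  have "germ \<theta> (s' * t') y = germ \<theta> (s * t) z"
    if s': "(s', w') \<in> germ \<theta> s w" and t': "(t', y) \<in> germ \<theta> t z" and y: "\<theta> t' y = Some w'"
    for s' t' y w'
  proof -
    have [simp]: "y = z" "w' = w" using mem_germ_eq[OF s'] mem_germ_eq[OF t'] by auto
    obtain e where e: "e \<in> idems" "s * e = s' * e" "w \<in> act_dom \<theta> e"
      using s' by (auto simp: mem_germ)
    obtain f where f: "f \<in> idems" "t * f = t' * f" "z \<in> act_dom \<theta> f"
      using t' by (auto simp: mem_germ)
    let ?h = "(star t * e * t) * f"
    have h: "?h \<in> idems" using e f by simp
    have "z \<in> act_dom \<theta> ?h"
      using act_dom_mult act_dom_conj[OF t e(1)] e f by simp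
    moreover have "s' * t' * ?h = s * t * ?h"
    proof -
      have ff: "t * ?h = t' * ?h"
        using f(2) h by (metis conj_idems e(1) f(1) idems_commute mult.assoc)
      have "t * ?h = e * t * f" using idem_conj[OF e(1), of t] by (simp flip: mult.assoc)
      then have "s' * (t * ?h) = s * (t * ?h)" using e(2) by (metis mult.assoc)
      then show ?thesis using ff by (metis mult.assoc)
    qed
    moreover have "z \<in> source (s' * t')" "z \<in> source (s * t)"
      using mem_germ_eq[OF s'] y t s source_mult_iff by auto
    ultimately show ?thesis using germ_eq_iff[of z "s' * t'" "s * t"] h by auto
  qed
  then have "{germ \<theta> (s' * t') y | s' t' y w'. (s', w') \<in> germ \<theta> s w \<and> (t', y) \<in> germ \<theta> t z \<and>
      \<theta> t' y = Some w'} = {germ \<theta> (s * t) z}"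
    using germ_self[OF z] germ_self[OF s] t by blast
  then show ?thesis by (simp add: transformation_groupoid_def)
qed

text \<open>
  Right multiplication by the arrow \<open>[t, z]\<close> is injective; an idempotent \<open>e\<close> witnessing equality of
  the products is transported to \<open>tet\<^sup>*\<close>.
\<close>

lemma germ_mult_cancel_right:
  assumes t: "\<theta> t z = Some w" and s: "w \<in> source s" and s': "w \<in> source s'"
  shows "germ \<theta> (s * t) z = germ \<theta> (s' * t) z \<longleftrightarrow> germ \<theta> s w = germ \<theta> s' w"
proof
  assume "germ \<theta> s w = germ \<theta> s' w"
  then show "germ \<theta> (s * t) z = germ \<theta> (s' * t) z"
    using gmult_germ[OF t s] gmult_germ[OF t s'] by simp
next
  assume "germ \<theta> (s * t) z = germ \<theta> (s' * t) z"
  then obtain e where e: "e \<in> idems" "s * t * e = s' * t * e" "z \<in> act_dom \<theta> e"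
    using germ_eq_iff source_mult_iff[OF t] s s' by auto
  let ?f = "star (star t) * e * star t"
  have "w \<in> act_dom \<theta> ?f"
    using act_dom_conj[OF act_star[OF t] e(1)] e(3) by blast
  moreover have "s * ?f = s' * ?f" using e(2) by (simp add: mult.assoc) (metis mult.assoc)
  moreover have "?f \<in> idems" using e(1) by (rule conj_idems)
  ultimately show "germ \<theta> s w = germ \<theta> s' w" using germ_eq_iff s s' by blast
qed

lemma germ_mult_source:
  assumes t: "\<theta> t z = Some w" and e: "e \<in> idems" "w \<in> act_dom \<theta> e"
  shows "germ \<theta> (e * t) z = germ \<theta> t z"
proof -
  have z: "z \<in> act_dom \<theta> (star t * e * t)" using act_dom_conj[OF t e(1)] e(2) by blast
  have "e * t * (star t * e * t) = e * (t * (star t * e * t))" by (simp add: mult.assoc)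
  also have "\<dots> = e * (e * t)" using idem_conj[OF e(1), of t] by simp
  also have "\<dots> = t * (star t * e * t)"
    using idem_conj[OF e(1), of t] idemsD[OF e(1)] by (metis mult.assoc)
  finally have "e * t * (star t * e * t) = t * (star t * e * t)" .
  moreover have "z \<in> source t" using t mem_source by blast
  moreover have "z \<in> source (e * t)"
    using z by (simp add: source_idem_mult[OF e(1)])
  ultimately show ?thesis using germ_eq_iff z conj_idems[OF e(1)] by blast
qed

text \<open>
  Every germ at \<open>z\<close> is a left multiple of \<open>[t, z]\<close>: \<open>[u, z] = [ut\<^sup>*, w][t, z]\<close>.
\<close>

lemma germ_factor:
  assumes t: "\<theta> t z = Some w" and u: "z \<in> source u"
  shows "w \<in> source (u * star t)" and "germ \<theta> (u * star t * t) z = germ \<theta> u z"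
proof -
  show "w \<in> source (u * star t)" using source_mult_iff[OF act_star[OF t]] u by blast
  then have "z \<in> source (u * star t * t)" using source_mult_iff[OF t] by blast
  moreover have "z \<in> source t" using t mem_source by blast
  moreover have "u * star t * t * (star t * t) = u * (star t * t)"
    by (simp add: mult.assoc) (simp add: star_props flip: mult.assoc)
  ultimately show "germ \<theta> (u * star t * t) z = germ \<theta> u z"
    using germ_eq_iff u star_mult_idems(1) by blast
qed

lemma topspace_arrow: "topspace (arrow_top G) = {germ \<theta> s z | s z. z \<in> source s}"
proof -
  have "topspace (arrow_top G)
      = \<Union>{germ \<theta> s ` U | s U. openin Z U \<and> U \<subseteq> source s}"
    by (simp add: transformation_groupoid_def topology_generated_by_topspace)
  also have "\<dots> = {germ \<theta> s z | s z. z \<in> source s}"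
    (is "\<Union>?B = ?R")
  proof
    show "?R \<subseteq> \<Union>?B"
    proof
      fix \<gamma> assume "\<gamma> \<in> ?R"
      then obtain s z where "\<gamma> = germ \<theta> s z" "z \<in> source s" by blast
      then have "\<gamma> \<in> germ \<theta> s ` source s" by blast
      moreover have "germ \<theta> s ` source s \<in> ?B"
        using open_act_dom[OF star_mult_idems(1)] by blast
      ultimately show "\<gamma> \<in> \<Union>?B" by blast
    qed
  qed blast
  finally show ?thesis .
qed

lemma src_fiber_eq: "src_fiber G z = {germ \<theta> s z | s. z \<in> source s}"
  unfolding src_fiber_def topspace_arrow by (auto simp: src_germ)

lemma src_fiberE:
  assumes "\<gamma> \<in> src_fiber G z"
  obtains t w where "\<gamma> = germ \<theta> t z" "\<theta> t z = Some w" "z \<in> source t" "tgt G \<gamma> = w"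
proof -
  obtain t where t: "\<gamma> = germ \<theta> t z" "z \<in> source t"
    using assms unfolding src_fiber_eq by blast
  then obtain w where "\<theta> t z = Some w" using mem_source by blast
  then show ?thesis using that t tgt_germ by metis
qed

lemma bij_betw_gmult:
  assumes \<gamma>: "\<gamma> \<in> src_fiber G z"
  shows "bij_betw (\<lambda>\<beta>. gmult G \<beta> \<gamma>) (src_fiber G (tgt G \<gamma>)) (src_fiber G z)"
proof -
  obtain t w where t: "\<gamma> = germ \<theta> t z" "\<theta> t z = Some w" "tgt G \<gamma> = w"
    using \<gamma> by (blast elim: src_fiberE)
  show ?thesis
    unfolding t(3)
  proof (rule bij_betw_imageI)
    show "inj_on (\<lambda>\<beta>. gmult G \<beta> \<gamma>) (src_fiber G w)"
    proof (rule inj_onI)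
      fix \<beta> \<beta>' assume "\<beta> \<in> src_fiber G w" "\<beta>' \<in> src_fiber G w" and eq: "gmult G \<beta> \<gamma> = gmult G \<beta>' \<gamma>"
      then obtain s s' where s: "\<beta> = germ \<theta> s w" "w \<in> source s" "\<beta>' = germ \<theta> s' w" "w \<in> source s'"
        unfolding src_fiber_eq by blast
      show "\<beta> = \<beta>'"
        using eq germ_mult_cancel_right[OF t(2) s(2,4)] unfolding s t(1) gmult_germ[OF t(2) s(2)]
          gmult_germ[OF t(2) s(4)] by blast
    qed
    have "gmult G \<beta> \<gamma> \<in> src_fiber G z" if \<beta>: "\<beta> \<in> src_fiber G w" for \<beta>
    proof -
      obtain s where s: "\<beta> = germ \<theta> s w" "w \<in> source s"
        using \<beta> unfolding src_fiber_eq by blast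
      show ?thesis
        using s source_mult_iff[OF t(2), of s] unfolding s t(1) gmult_germ[OF t(2) s(2)] src_fiber_eq
        by blast
    qed
    moreover have "germ \<theta> u z \<in> (\<lambda>\<beta>. gmult G \<beta> \<gamma>) ` src_fiber G w" if "z \<in> source u" for u
    proof (rule image_eqI)
      show "germ \<theta> (u * star t) w \<in> src_fiber G w"
        using germ_factor(1)[OF t(2) that] unfolding src_fiber_eq by blast
      show "germ \<theta> u z = gmult G (germ \<theta> (u * star t) w) \<gamma>"
        using gmult_germ[OF t(2) germ_factor(1)[OF t(2) that]] germ_factor(2)[OF t(2) that]
        by (simp add: t(1))
    qed
    ultimately show "(\<lambda>\<beta>. gmult G \<beta> \<gamma>) ` src_fiber G w = src_fiber G z"
      unfolding src_fiber_eq[of z] by blast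
  qed
qed

text \<open>
  The arrow \<open>\<alpha>\<gamma>\<^sup>-\<^sup>1\<close>, for \<open>\<alpha>\<close> and \<open>\<gamma>\<close> with the same source, obtained by inverting right multiplication by \<open>\<gamma>\<close>.
\<close>

definition quotient :: "('s \<times> 'z) set \<Rightarrow> ('s \<times> 'z) set \<Rightarrow> ('s \<times> 'z) set" where
  "quotient \<alpha> \<gamma> = inv_into (src_fiber G (tgt G \<gamma>)) (\<lambda>\<beta>. gmult G \<beta> \<gamma>) \<alpha>"

lemma quotient_gmult:
  "\<gamma> \<in> src_fiber G z \<Longrightarrow> \<beta> \<in> src_fiber G (tgt G \<gamma>) \<Longrightarrow> quotient (gmult G \<beta> \<gamma>) \<gamma> = \<beta>"
  unfolding quotient_def using bij_betw_gmult bij_betw_inv_into_left by fastforce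

lemma gmult_quotient:
  assumes "\<gamma> \<in> src_fiber G z" "\<alpha> \<in> src_fiber G z"
  shows "quotient \<alpha> \<gamma> \<in> src_fiber G (tgt G \<gamma>)" and "gmult G (quotient \<alpha> \<gamma>) \<gamma> = \<alpha>"
  using bij_betw_inv_into[OF bij_betw_gmult[OF assms(1)]]
    bij_betw_inv_into_right[OF bij_betw_gmult[OF assms(1)] assms(2)] assms(2)
  by (auto simp: quotient_def bij_betw_def)

lemma quotient_germ:
  assumes t: "\<theta> t z = Some w" and u: "z \<in> source u"
  shows "quotient (germ \<theta> u z) (germ \<theta> t z) = germ \<theta> (u * star t) w"
proof -
  have "germ \<theta> t z \<in> src_fiber G z" using t by (auto simp: src_fiber_eq mem_source)
  moreover have "germ \<theta> (u * star t) w \<in> src_fiber G (tgt G (germ \<theta> t z))"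
    using germ_factor(1)[OF t u] tgt_germ[OF t] by (auto simp: src_fiber_eq)
  ultimately show ?thesis
    using quotient_gmult gmult_germ[OF t germ_factor(1)[OF t u]] germ_factor(2)[OF t u] by metis
qed

lemma tgt_gmult:
  assumes "\<gamma> \<in> src_fiber G z" "\<beta> \<in> src_fiber G (tgt G \<gamma>)"
  shows "tgt G (gmult G \<beta> \<gamma>) = tgt G \<beta>"
proof -
  obtain t w where t: "\<gamma> = germ \<theta> t z" "\<theta> t z = Some w" "tgt G \<gamma> = w"
    using assms(1) by (blast elim: src_fiberE)
  obtain s v where s: "\<beta> = germ \<theta> s w" "\<theta> s w = Some v" "w \<in> source s" "tgt G \<beta> = v"
    using assms(2) unfolding t(3) by (blast elim: src_fiberE)
  have "\<theta> (s * t) z = Some v" using s(2) t(2) act_mult_Some by blast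
  then show ?thesis
    unfolding s(4) unfolding s(1) t(1) gmult_germ[OF t(2) s(3)] by (rule tgt_germ)
qed

lemma gmult_cancel_left:
  assumes \<gamma>: "\<gamma> \<in> src_fiber G z" and \<gamma>': "\<gamma>' \<in> src_fiber G z"
    and \<beta>: "\<beta> \<in> src_fiber G (tgt G \<gamma>)" "\<beta> \<in> src_fiber G (tgt G \<gamma>')"
    and eq: "gmult G \<beta> \<gamma> = gmult G \<beta> \<gamma>'"
  shows "\<gamma> = \<gamma>'"
proof -
  obtain t w where t: "\<gamma> = germ \<theta> t z" "\<theta> t z = Some w" "z \<in> source t" "tgt G \<gamma> = w"
    using \<gamma> by (blast elim: src_fiberE)
  have w': "tgt G \<gamma>' = w" using \<beta> t(4) by (simp add: src_fiber_def)
  obtain t' where t': "\<gamma>' = germ \<theta> t' z" "\<theta> t' z = Some w" "z \<in> source t'"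
    using \<gamma>' w' by (blast elim: src_fiberE)
  obtain s where s: "\<beta> = germ \<theta> s w" "w \<in> source s"
    using \<beta>(1) unfolding t(4) src_fiber_eq by blast
  have "germ \<theta> (s * t) z = germ \<theta> (s * t') z"
    using eq unfolding s(1) t(1) t'(1) gmult_germ[OF t(2) s(2)] gmult_germ[OF t'(2) s(2)] .
  then obtain e where e: "e \<in> idems" "s * t * e = s * t' * e" "z \<in> act_dom \<theta> e"
    using germ_eq_iff[of z "s * t" "s * t'"] source_mult_iff[OF t(2), of s]
      source_mult_iff[OF t'(2), of s] s(2) by blast
  \<comment> \<open>Multiplying by \<open>s\<^sup>*\<close> on the left cancels \<open>s\<close> up to \<open>s\<^sup>*s\<close>, which fixes \<open>w\<close>.\<close>
  have "germ \<theta> (star s * s * t) z = germ \<theta> (star s * s * t') z"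
  proof (subst germ_eq_iff)
    show "z \<in> source (star s * s * t)" "z \<in> source (star s * s * t')"
      using source_mult_iff[OF t(2), of "star s * s"] source_mult_iff[OF t'(2), of "star s * s"] s(2)
      by (simp_all add: idemsD)
    show "\<exists>e\<in>idems. star s * s * t * e = star s * s * t' * e \<and> z \<in> act_dom \<theta> e"
    proof (intro bexI conjI)
      show "star s * s * t * e = star s * s * t' * e" using e(2) by (simp add: mult.assoc)
    qed (use e in auto)
  qed
  then show ?thesis
    using germ_mult_source[OF t(2) star_mult_idems(1) s(2)]
      germ_mult_source[OF t'(2) star_mult_idems(1) s(2)] t(1) t'(1) by simp
qed

end

section \<open>The regular representations of a transformation groupoid\<close>

lemma Cc_on_compact_support:
  assumes "f \<in> Cc_on T U" "U \<subseteq> topspace T"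
  obtains K where "compactin T K" "K \<subseteq> U" "\<And>\<gamma>. \<gamma> \<notin> K \<Longrightarrow> f \<gamma> = 0"
proof
  let ?K = "subtopology T U closure_of {\<gamma> \<in> U. f \<gamma> \<noteq> 0}"
  show "compactin T ?K" "?K \<subseteq> U"
    using assms(1) by (auto simp: Cc_on_def compactin_subtopology)
  have "{\<gamma> \<in> U. f \<gamma> \<noteq> 0} \<subseteq> ?K"
    using assms(2) by (intro closure_of_subset) auto
  then show "f \<gamma> = 0" if "\<gamma> \<notin> ?K" for \<gamma>
    using assms(1) that by (cases "\<gamma> \<in> U") (auto simp: Cc_on_def)
qed

lemma Cc_on_bounded:
  assumes f: "f \<in> Cc_on T U" and "U \<subseteq> topspace T"
  obtains C where "0 \<le> C" "\<And>\<gamma>. cmod (f \<gamma>) \<le> C"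
proof -
  obtain K where K: "compactin T K" "K \<subseteq> U" "\<And>\<gamma>. \<gamma> \<notin> K \<Longrightarrow> f \<gamma> = 0"
    using Cc_on_compact_support[OF assms] by blast
  have "compactin euclidean (f ` K)"
    by (rule image_compactin[of "subtopology T U"])
      (use f K in \<open>auto simp: Cc_on_def compactin_subtopology\<close>)
  then have "bounded (f ` K)" by (simp add: compact_imp_bounded)
  then obtain C where C: "0 < C" "\<And>w. w \<in> f ` K \<Longrightarrow> cmod w \<le> C" by (auto simp: bounded_pos)
  have "cmod (f \<gamma>) \<le> C" for \<gamma> using C K(3)[of \<gamma>] by (cases "\<gamma> \<in> K") auto
  then show ?thesis using that[of C] C(1) by simp
qed

context partial_action
begin

abbreviation conv_matrix ::
    "(('s \<times> 'z) set \<Rightarrow> complex) \<Rightarrow> ('s \<times> 'z) set \<Rightarrow> ('s \<times> 'z) set \<Rightarrow> complex" where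
  "conv_matrix f \<alpha> \<gamma> \<equiv> f (quotient \<alpha> \<gamma>)"

text \<open>
  The only arrow \<open>\<beta>\<close> with \<open>\<beta>\<gamma> = \<alpha>\<close> is \<open>\<alpha>\<gamma>\<^sup>-\<^sup>1\<close>, so the convolution sum collapses to a single term.
\<close>

lemma convolution_coefficient:
  assumes \<gamma>: "\<gamma> \<in> src_fiber G z"
  shows "(\<Sum>\<^sub>\<infinity>\<beta>\<in>src_fiber G (tgt G \<gamma>). f \<beta> * delta (gmult G \<beta> \<gamma>) \<alpha>)
    = (if \<alpha> \<in> src_fiber G z then conv_matrix f \<alpha> \<gamma> else 0)"
proof (cases "\<alpha> \<in> src_fiber G z")
  case True
  note q = gmult_quotient[OF \<gamma> True]
  have "((\<lambda>\<beta>. f \<beta> * delta (gmult G \<beta> \<gamma>) \<alpha>) has_sum conv_matrix f \<alpha> \<gamma>) (src_fiber G (tgt G \<gamma>))"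
  proof (rule has_sum_finite_neutralI[of "{quotient \<alpha> \<gamma>}"])
    show "f \<beta> * delta (gmult G \<beta> \<gamma>) \<alpha> = 0"
      if \<beta>: "\<beta> \<in> src_fiber G (tgt G \<gamma>) - {quotient \<alpha> \<gamma>}" for \<beta>
      using quotient_gmult[OF \<gamma>, of \<beta>] \<beta> by (auto simp: delta_def)
  qed (use q in \<open>auto simp: delta_def\<close>)
  then show ?thesis using True by (simp add: infsumI)
next
  case False
  have "f \<beta> * delta (gmult G \<beta> \<gamma>) \<alpha> = 0" if "\<beta> \<in> src_fiber G (tgt G \<gamma>)" for \<beta>
    using bij_betwE[OF bij_betw_gmult[OF \<gamma>]] that False by (auto simp: delta_def)
  then show ?thesis using False by (simp add: infsum_0)
qed

text \<open>
  A bound for the finite sections yields an operator with this matrix, which is unique; so the definite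
  description denotes it.
\<close>

lemma left_regular_has_matrix:
  assumes "sections_bounded (src_fiber G z) (conv_matrix f) C" "0 \<le> C"
  shows "has_matrix (src_fiber G z) (left_regular G z f) (conv_matrix f)"
proof -
  obtain T where T: "has_matrix (src_fiber G z) T (conv_matrix f)"
    using sections_bounded_has_matrix[OF assms] by blast
  have eq: "left_regular G z f = (THE T. has_matrix (src_fiber G z) T (conv_matrix f))"
    unfolding left_regular_def has_matrix_def
    by (intro arg_cong[of _ _ The] ext conj_cong refl ball_cong) (simp add: convolution_coefficient)
  show ?thesis unfolding eq by (rule theI[where a = T]) (use T has_matrix_unique in blast)+
qed

lemma left_regular_norm_nonneg:
  assumes "sections_bounded (src_fiber G z) (conv_matrix f) C" "0 \<le> C"
  shows "0 \<le> left_regular_norm G z f"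
  unfolding left_regular_norm_def by (rule op_norm_nonneg[OF left_regular_has_matrix[OF assms]])

lemma left_regular_norm_le_iff:
  assumes "sections_bounded (src_fiber G z) (conv_matrix f) C" "0 \<le> C" "0 \<le> D"
  shows "left_regular_norm G z f \<le> D \<longleftrightarrow> sections_bounded (src_fiber G z) (conv_matrix f) D"
  unfolding left_regular_norm_def
  by (rule op_norm_le_iff[OF left_regular_has_matrix[OF assms(1,2)] assms(3)])

text \<open>
  On a bisection \<open>\<alpha>\<gamma>\<^sup>-\<^sup>1\<close> is determined by its target, that of \<open>\<alpha>\<close>, and also by its source, that is by the target
  of \<open>\<gamma>\<close>. By cancellation each row and each column of the matrix has at most one nonzero entry.
\<close>

lemma bisection_sections_bounded:
  assumes f: "f \<in> Cc_on (arrow_top G) U" and U: "open_bisection G U" and C: "\<And>\<gamma>. cmod (f \<gamma>) \<le> C"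
  shows "sections_bounded (src_fiber G z) (conv_matrix f) C"
proof (rule sections_bounded_monomial)
  have inU: "\<beta> \<in> U" if "f \<beta> \<noteq> 0" for \<beta> using f that by (auto simp: Cc_on_def)
  have inj_src: "inj_on (src G) U" and inj_tgt: "inj_on (tgt G) U"
    using U by (simp_all add: open_bisection_def)
  show "cmod (conv_matrix f \<alpha> \<gamma>) \<le> C" for \<alpha> \<gamma> by (rule C)
  show "\<gamma> = \<gamma>'"
    if \<alpha>: "\<alpha> \<in> src_fiber G z" and \<gamma>: "\<gamma> \<in> src_fiber G z" and \<gamma>': "\<gamma>' \<in> src_fiber G z"
      and nz: "conv_matrix f \<alpha> \<gamma> \<noteq> 0" "conv_matrix f \<alpha> \<gamma>' \<noteq> 0" for \<alpha> \<gamma> \<gamma>'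
  proof -
    note q = gmult_quotient[OF \<gamma> \<alpha>] and q' = gmult_quotient[OF \<gamma>' \<alpha>]
    have "tgt G (quotient \<alpha> \<gamma>) = tgt G (quotient \<alpha> \<gamma>')"
      using tgt_gmult[OF \<gamma> q(1)] tgt_gmult[OF \<gamma>' q'(1)] q(2) q'(2) by simp
    then have eq: "quotient \<alpha> \<gamma> = quotient \<alpha> \<gamma>'"
      by (rule inj_onD[OF inj_tgt _ inU[OF nz(1)] inU[OF nz(2)]])
    have "gmult G (quotient \<alpha> \<gamma>) \<gamma> = gmult G (quotient \<alpha> \<gamma>) \<gamma>'"
      by (rule trans[OF q(2) trans[OF q'(2)[symmetric] arg_cong[OF eq[symmetric], of "\<lambda>\<beta>. gmult G \<beta> \<gamma>'"]]])
    moreover have "quotient \<alpha> \<gamma> \<in> src_fiber G (tgt G \<gamma>')" unfolding eq by (rule q'(1))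
    ultimately show ?thesis using gmult_cancel_left[OF \<gamma> \<gamma>' q(1)] by blast
  qed
  show "\<alpha> = \<alpha>'"
    if \<alpha>: "\<alpha> \<in> src_fiber G z" and \<alpha>': "\<alpha>' \<in> src_fiber G z" and \<gamma>: "\<gamma> \<in> src_fiber G z"
      and nz: "conv_matrix f \<alpha> \<gamma> \<noteq> 0" "conv_matrix f \<alpha>' \<gamma> \<noteq> 0" for \<alpha> \<alpha>' \<gamma>
  proof -
    note q = gmult_quotient[OF \<gamma> \<alpha>] and q' = gmult_quotient[OF \<gamma> \<alpha>']
    have "src G (quotient \<alpha> \<gamma>) = src G (quotient \<alpha>' \<gamma>)"
      using q(1) q'(1) by (simp add: src_fiber_def)
    then have eq: "quotient \<alpha> \<gamma> = quotient \<alpha>' \<gamma>"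
      by (rule inj_onD[OF inj_src _ inU[OF nz(1)] inU[OF nz(2)]])
    show ?thesis
      by (rule trans[OF q(2)[symmetric] trans[OF arg_cong[OF eq, of "\<lambda>\<beta>. gmult G \<beta> \<gamma>"] q'(2)]])
  qed
qed

text \<open>
  The bound is uniform over all units; so the suprema defining the norms are over bounded sets.
\<close>

lemma conv_algebra_sections_bounded:
  assumes "g \<in> conv_algebra G"
  obtains C where "0 \<le> C" "\<And>z. sections_bounded (src_fiber G z) (conv_matrix g) C"
proof -
  have "\<exists>C\<ge>0. \<forall>z. sections_bounded (src_fiber G z) (conv_matrix g) C"
    using assms unfolding conv_algebra_def
  proof (induction rule: complex_fun.span_induct_alt)
    case base
    then show ?case by (intro exI[of _ 0]) (simp add: sections_bounded_def)
  next
    case (step c f h)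
    then obtain U where U: "open_bisection G U" "f \<in> Cc_on (arrow_top G) U" by blast
    then have "U \<subseteq> topspace (arrow_top G)" by (simp add: open_bisection_def openin_subset)
    then obtain C where C: "0 \<le> C" "\<And>\<gamma>. cmod (f \<gamma>) \<le> C" using Cc_on_bounded[OF U(2)] by blast
    obtain D where D: "0 \<le> D" "\<And>z. sections_bounded (src_fiber G z) (conv_matrix h) D"
      using step by blast
    have "sections_bounded (src_fiber G z)
        (\<lambda>\<alpha> \<gamma>. c * conv_matrix f \<alpha> \<gamma> + conv_matrix h \<alpha> \<gamma>) (2 * (cmod c * C + D))" for z
      by (rule sections_bounded_add[OF sections_bounded_scale[OF bisection_sections_bounded[OF U(2,1) C(2)]] D(2)])
        (simp_all add: C D)
    then show ?case using C D by (intro exI[of _ "2 * (cmod c * C + D)"]) simp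
  qed
  then show ?thesis using that by blast
qed

section \<open>Limits of germs\<close>

lemma openin_germs:
  assumes "openin Z V"
  shows "openin (arrow_top G) (germ \<theta> s ` (V \<inter> source s))"
proof -
  have "openin Z (V \<inter> source s)" using assms open_act_dom by (simp add: openin_Int)
  then show ?thesis
    unfolding transformation_groupoid_def
    by (simp only: top_groupoid.simps) (rule topology_generated_by_Basis, blast)
qed

lemma continuous_map_src: "continuous_map (arrow_top G) Z (src G)"
  unfolding continuous_map
proof (intro conjI allI impI)
  show "src G ` topspace (arrow_top G) \<subseteq> topspace Z"
    using subsetD[OF source_subset] by (auto simp: topspace_arrow src_germ)
  fix V assume V: "openin Z V"
  have "{\<gamma> \<in> topspace (arrow_top G). src G \<gamma> \<in> V} = (\<Union>s. germ \<theta> s ` (V \<inter> source s))"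
    (is "?L = ?R")
  proof
    show "?L \<subseteq> ?R"
    proof
      fix \<gamma> assume "\<gamma> \<in> ?L"
      then obtain s z where "\<gamma> = germ \<theta> s z" "z \<in> source s" "z \<in> V"
        by (auto simp: topspace_arrow src_germ)
      then show "\<gamma> \<in> ?R" by blast
    qed
  qed (auto simp: topspace_arrow src_germ)
  then show "openin (arrow_top G) {\<gamma> \<in> topspace (arrow_top G). src G \<gamma> \<in> V}"
    using openin_germs[OF V] by auto
qed

text \<open>
  The preimage of a basic open set \<open>[t, V]\<close> consists of the \<open>z \<in> V\<close> at which \<open>s\<close> and \<open>t\<close> have the same germ,
  an open condition since it is witnessed on a whole \<open>Z\<^sub>e\<close>.
\<close>

lemma continuous_map_germ: "continuous_map (subtopology Z (source s)) (arrow_top G) (germ \<theta> s)"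
proof -
  let ?B = "{germ \<theta> s ` U | s U. openin Z U \<and> U \<subseteq> source s}"
  have "continuous_map (subtopology Z (source s)) (topology_generated_by ?B) (germ \<theta> s)"
  proof (rule continuous_on_generated_topo)
    fix W assume "W \<in> ?B"
    then obtain t V where W: "W = germ \<theta> t ` V" "openin Z V" "V \<subseteq> source t" by blast
    have "germ \<theta> s -` W \<inter> topspace (subtopology Z (source s))
        = (\<Union>e\<in>{e \<in> idems. s * e = t * e}. V \<inter> act_dom \<theta> e) \<inter> source s"
      (is "?L = ?R")
    proof
      show "?L \<subseteq> ?R"
      proof
        fix z assume "z \<in> ?L"
        then obtain v where v: "z \<in> source s" "v \<in> V" "germ \<theta> s z = germ \<theta> t v" by (auto simp: W(1))
        have "v = z" using germ_inj[OF v(1,3)] by simp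
        then have "v = z" "z \<in> source t" using W(3) v(2) by auto
        then show "z \<in> ?R" using v germ_eq_iff[of z s t] by auto
      qed
      show "?R \<subseteq> ?L"
      proof
        fix z assume "z \<in> ?R"
        then have z: "z \<in> source s" "z \<in> V" "\<exists>e\<in>idems. s * e = t * e \<and> z \<in> act_dom \<theta> e" by auto
        then have "germ \<theta> s z = germ \<theta> t z" using germ_eq_iff[of z s t] W(3) by blast
        then show "z \<in> ?L" using z source_subset by (auto simp: W(1))
      qed
    qed
    moreover have "openin (subtopology Z (source s)) ?R"
    proof -
      have "openin Z (\<Union>e\<in>{e \<in> idems. s * e = t * e}. V \<inter> act_dom \<theta> e)"
        using W(2) open_act_dom by (intro openin_Union) auto
      then show ?thesis by (auto simp: openin_subtopology)
    qed
    ultimately show "openin (subtopology Z (source s))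
        (germ \<theta> s -` W \<inter> topspace (subtopology Z (source s)))"
      by simp
  next
    have "germ \<theta> s ` source s \<in> ?B" using open_act_dom[OF star_mult_idems(1)] by blast
    then show "germ \<theta> s ` topspace (subtopology Z (source s)) \<subseteq> \<Union>?B" by auto
  qed
  then show ?thesis by (simp add: transformation_groupoid_def)
qed

lemma eventually_mem_source:
  assumes "limitin Z \<zeta> z \<Phi>" "z \<in> source s"
  shows "\<forall>\<^sub>F i in \<Phi>. \<zeta> i \<in> source s"
  using assms open_act_dom[OF star_mult_idems(1)] by (auto simp: limitin_def)

lemma limitin_germ:
  assumes lim: "limitin Z \<zeta> z \<Phi>" and z: "z \<in> source s"
  shows "limitin (arrow_top G) (\<lambda>i. germ \<theta> s (\<zeta> i)) (germ \<theta> s z) \<Phi>"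
proof -
  have "limitin (subtopology Z (source s)) \<zeta> z \<Phi>"
    using lim z eventually_mem_source[OF lim z] by (simp add: limitin_subtopology)
  then have "limitin (arrow_top G) (germ \<theta> s \<circ> \<zeta>) (germ \<theta> s z) \<Phi>"
    by (rule continuous_map_limit[OF continuous_map_germ])
  then show ?thesis by (simp add: comp_def)
qed

text \<open>
  For a continuous action on a Hausdorff space and units \<open>\<zeta> i\<close> converging to \<open>z\<close>, this says that the \<open>\<zeta> i\<close> do
  not accumulate at a nontrivial isotropy element over \<open>z\<close>. It is stated through germs because all comparisons
  below are between germs at \<open>z\<close> and germs of the same semigroup elements at \<open>\<zeta> i\<close>.
\<close>

definition separates_germs :: "('i \<Rightarrow> 'z) \<Rightarrow> 'z \<Rightarrow> 'i filter \<Rightarrow> bool" where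
  "separates_germs \<zeta> z \<Phi> \<longleftrightarrow> (\<forall>s t. z \<in> source s \<longrightarrow> z \<in> source t \<longrightarrow> germ \<theta> s z \<noteq> germ \<theta> t z \<longrightarrow>
     (\<forall>\<^sub>F i in \<Phi>. germ \<theta> s (\<zeta> i) \<noteq> germ \<theta> t (\<zeta> i)))"

lemma separates_germsD:
  assumes "separates_germs \<zeta> z \<Phi>" "z \<in> source s" "z \<in> source t" "germ \<theta> s z \<noteq> germ \<theta> t z"
  shows "\<forall>\<^sub>F i in \<Phi>. germ \<theta> s (\<zeta> i) \<noteq> germ \<theta> t (\<zeta> i)"
  using assms by (auto simp: separates_germs_def)

text \<open>
  If \<open>[s, z] \<in> U\<close>, this is continuity of \<open>f\<close> on \<open>U\<close>. Otherwise \<open>f([s, \<zeta>\<^sub>i])\<close> vanishes eventually. Indeed, if a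
  compact set \<open>K \<subseteq> U\<close> carrying \<open>f\<close> contains a germ \<open>[t, z]\<close>, then \<open>[t, \<zeta>\<^sub>i]\<close> lies in \<open>U\<close> eventually and is different from
  \<open>[s, \<zeta>\<^sub>i]\<close>; since the source map is injective on \<open>U\<close>, the germ \<open>[s, \<zeta>\<^sub>i]\<close> lies outside \<open>U\<close>. If \<open>K\<close> contains no
  germ at \<open>z\<close>, then \<open>z\<close> is outside the closed set \<open>d(K)\<close>, and so is \<open>\<zeta>\<^sub>i\<close> eventually.
\<close>

lemma tendsto_Cc_on_germ:
  assumes haus: "Hausdorff_space Z"
    and lim: "limitin Z \<zeta> z \<Phi>" and sep: "separates_germs \<zeta> z \<Phi>" and s: "z \<in> source s"
    and U: "open_bisection G U" and f: "f \<in> Cc_on (arrow_top G) U"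
  shows "((\<lambda>i. f (germ \<theta> s (\<zeta> i))) \<longlongrightarrow> f (germ \<theta> s z)) \<Phi>"
proof (cases "germ \<theta> s z \<in> U")
  have openU: "openin (arrow_top G) U" using U by (simp add: open_bisection_def)
  have mem_U: "\<forall>\<^sub>F i in \<Phi>. germ \<theta> t (\<zeta> i) \<in> U" if "germ \<theta> t z \<in> U" "z \<in> source t" for t
    using limitin_germ[OF lim that(2)] openU that(1) by (auto simp: limitin_def)
  {
    case True
    have "limitin (subtopology (arrow_top G) U) (\<lambda>i. germ \<theta> s (\<zeta> i)) (germ \<theta> s z) \<Phi>"
      using limitin_germ[OF lim s] mem_U[OF True s] True by (simp add: limitin_subtopology)
    then have "limitin euclidean (f \<circ> (\<lambda>i. germ \<theta> s (\<zeta> i))) (f (germ \<theta> s z)) \<Phi>"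
      by (rule continuous_map_limit[rotated]) (use f in \<open>simp add: Cc_on_def\<close>)
    then show ?thesis by (simp add: comp_def)
  next
    case False
    have subU: "U \<subseteq> topspace (arrow_top G)" using openU by (rule openin_subset)
    obtain K where K: "compactin (arrow_top G) K" "K \<subseteq> U" "\<And>\<gamma>. \<gamma> \<notin> K \<Longrightarrow> f \<gamma> = 0"
      using Cc_on_compact_support[OF f subU] by blast
    have "\<forall>\<^sub>F i in \<Phi>. f (germ \<theta> s (\<zeta> i)) = 0"
    proof (cases "z \<in> src G ` K")
      case True
      then obtain \<gamma> where \<gamma>: "\<gamma> \<in> K" "src G \<gamma> = z" by blast
      then have "\<gamma> \<in> src_fiber G z" using K(2) subU by (auto simp: src_fiber_def)
      then obtain t where t: "\<gamma> = germ \<theta> t z" "z \<in> source t"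
        unfolding src_fiber_eq by blast
      then have tU: "germ \<theta> t z \<in> U" using \<gamma> K(2) by blast
      then have "germ \<theta> s z \<noteq> germ \<theta> t z" using False by auto
      from separates_germsD[OF sep s t(2) this] mem_U[OF tU t(2)]
        eventually_mem_source[OF lim s] eventually_mem_source[OF lim t(2)]
      show ?thesis
      proof eventually_elim
        case (elim i)
        have "germ \<theta> s (\<zeta> i) \<notin> U"
        proof
          assume "germ \<theta> s (\<zeta> i) \<in> U"
          moreover have "src G (germ \<theta> s (\<zeta> i)) = src G (germ \<theta> t (\<zeta> i))"
            using elim by (simp add: src_germ)
          ultimately have "germ \<theta> s (\<zeta> i) = germ \<theta> t (\<zeta> i)"
            using U elim(2) unfolding open_bisection_def inj_on_def by blast
          with elim(1) show False ..
        qed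
        then show ?case using K by blast
      qed
    next
      case False
      have "compactin Z (src G ` K)" by (rule image_compactin[OF K(1) continuous_map_src])
      then have "closedin Z (src G ` K)" by (rule compactin_imp_closedin[OF haus])
      then have "openin Z (topspace Z - src G ` K)" by (simp add: openin_diff)
      moreover have "z \<in> topspace Z - src G ` K" using False s source_subset by blast
      ultimately have "\<forall>\<^sub>F i in \<Phi>. \<zeta> i \<in> topspace Z - src G ` K"
        using lim by (auto simp: limitin_def)
      with eventually_mem_source[OF lim s] show ?thesis
      proof eventually_elim
        case (elim i)
        then have "germ \<theta> s (\<zeta> i) \<notin> K" using src_germ by (metis DiffD2 image_eqI)
        then show ?case by (rule K(3))
      qed
    qed
    moreover have "f (germ \<theta> s z) = 0" using False K by blast
    ultimately show ?thesis by (simp add: tendsto_eventually)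
  }
qed

lemma tendsto_conv_algebra_germ:
  assumes "Hausdorff_space Z" "limitin Z \<zeta> z \<Phi>" "separates_germs \<zeta> z \<Phi>" "z \<in> source s"
    and "g \<in> conv_algebra G"
  shows "((\<lambda>i. g (germ \<theta> s (\<zeta> i))) \<longlongrightarrow> g (germ \<theta> s z)) \<Phi>"
  using assms(5) unfolding conv_algebra_def
proof (induction rule: complex_fun.span_induct_alt)
  case base
  then show ?case by simp
next
  case (step c f h)
  then obtain U where U: "open_bisection G U" "f \<in> Cc_on (arrow_top G) U" by blast
  show ?case
    using tendsto_add[OF tendsto_mult[OF tendsto_const tendsto_Cc_on_germ[OF assms(1-4) U]] step(2)]
    by simp
qed

text \<open>
  The matrix entry at \<open>([u, z], [t, z])\<close> is the value of \<open>g\<close> at \<open>[ut\<^sup>*, \<theta>\<^sub>t(z)]\<close>, a germ at \<open>\<theta>\<^sub>t(z)\<close> rather than at \<open>z\<close>.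
  So the pointwise convergence is applied to the translated net \<open>\<theta>\<^sub>t(\<zeta>\<^sub>i)\<close>, which again separates germs because
  right multiplication by \<open>[t, \<zeta>\<^sub>i]\<close> is injective.
\<close>

theorem left_regular_norm_le_limit:
  assumes haus: "Hausdorff_space Z" and g: "g \<in> conv_algebra G" and \<Phi>: "\<Phi> \<noteq> bot"
    and lim: "limitin Z \<zeta> z \<Phi>"
    and lim_act: "\<And>t w. \<theta> t z = Some w \<Longrightarrow> limitin Z (\<lambda>i. the (\<theta> t (\<zeta> i))) w \<Phi>"
    and sep: "separates_germs \<zeta> z \<Phi>"
    and C: "0 \<le> C" and le: "\<forall>\<^sub>F i in \<Phi>. left_regular_norm G (\<zeta> i) g \<le> C"
  shows "left_regular_norm G z g \<le> C"
proof -
  obtain D where D: "0 \<le> D" "\<And>z. sections_bounded (src_fiber G z) (conv_matrix g) D"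
    using conv_algebra_sections_bounded[OF g] by blast
  define rep where "rep \<gamma> = (SOME s. \<gamma> = germ \<theta> s z \<and> z \<in> source s)" for \<gamma>
  have rep: "\<gamma> = germ \<theta> (rep \<gamma>) z" "z \<in> source (rep \<gamma>)" if "\<gamma> \<in> src_fiber G z" for \<gamma>
  proof -
    have "\<exists>s. \<gamma> = germ \<theta> s z \<and> z \<in> source s" using that src_fiber_eq by auto
    from someI_ex[OF this] show "\<gamma> = germ \<theta> (rep \<gamma>) z" "z \<in> source (rep \<gamma>)"
      by (simp_all add: rep_def)
  qed
  have "sections_bounded (src_fiber G z) (conv_matrix g) C"
  proof (rule sections_bounded_limit[where \<phi> = "\<lambda>i \<gamma>. germ \<theta> (rep \<gamma>) (\<zeta> i)"
        and B = "\<lambda>i. src_fiber G (\<zeta> i)" and l = "\<lambda>i. conv_matrix g", OF \<Phi>])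
    show "\<forall>\<^sub>F i in \<Phi>. sections_bounded (src_fiber G (\<zeta> i)) (conv_matrix g) C"
      using le left_regular_norm_le_iff[OF D(2,1) C] by simp
    show "\<forall>\<^sub>F i in \<Phi>. germ \<theta> (rep \<gamma>) (\<zeta> i) \<in> src_fiber G (\<zeta> i)" if "\<gamma> \<in> src_fiber G z" for \<gamma>
      using eventually_mem_source[OF lim rep(2)[OF that]]
      by eventually_elim (auto simp: src_fiber_eq)
    show "\<forall>\<^sub>F i in \<Phi>. germ \<theta> (rep \<gamma>) (\<zeta> i) \<noteq> germ \<theta> (rep \<gamma>') (\<zeta> i)"
      if "\<gamma> \<in> src_fiber G z" "\<gamma>' \<in> src_fiber G z" "\<gamma> \<noteq> \<gamma>'" for \<gamma> \<gamma>'
      using separates_germsD[OF sep rep(2)[OF that(1)] rep(2)[OF that(2)]] rep(1) that by metis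
    show "((\<lambda>i. conv_matrix g (germ \<theta> (rep \<alpha>) (\<zeta> i)) (germ \<theta> (rep \<gamma>) (\<zeta> i))) \<longlongrightarrow> conv_matrix g \<alpha> \<gamma>) \<Phi>"
      if \<alpha>: "\<alpha> \<in> src_fiber G z" and \<gamma>: "\<gamma> \<in> src_fiber G z" for \<alpha> \<gamma>
    proof -
      define u where "u = rep \<alpha>"
      define t where "t = rep \<gamma>"
      have u: "\<alpha> = germ \<theta> u z" "z \<in> source u" using rep[OF \<alpha>] by (simp_all add: u_def)
      have t: "\<gamma> = germ \<theta> t z" "z \<in> source t" using rep[OF \<gamma>] by (simp_all add: t_def)
      obtain w where w: "\<theta> t z = Some w" using t(2) mem_source by blast
      let ?\<omega> = "\<lambda>i. the (\<theta> t (\<zeta> i))"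
      have \<omega>: "\<forall>\<^sub>F i in \<Phi>. \<theta> t (\<zeta> i) = Some (?\<omega> i)"
        using eventually_mem_source[OF lim t(2)] by eventually_elim (auto simp: mem_source)
      have sep_w: "separates_germs ?\<omega> w \<Phi>"
        unfolding separates_germs_def
      proof (intro allI impI)
        fix p q assume p: "w \<in> source p" and q: "w \<in> source q" and ne: "germ \<theta> p w \<noteq> germ \<theta> q w"
        have "germ \<theta> (p * t) z \<noteq> germ \<theta> (q * t) z"
          using germ_mult_cancel_right[OF w p q] ne by blast
        moreover have "z \<in> source (p * t)" "z \<in> source (q * t)"
          using source_mult_iff[OF w] p q by blast+
        ultimately have "\<forall>\<^sub>F i in \<Phi>. germ \<theta> (p * t) (\<zeta> i) \<noteq> germ \<theta> (q * t) (\<zeta> i)"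
          using separates_germsD[OF sep] by blast
        with \<omega> eventually_mem_source[OF lim_act[OF w] p] eventually_mem_source[OF lim_act[OF w] q]
        show "\<forall>\<^sub>F i in \<Phi>. germ \<theta> p (?\<omega> i) \<noteq> germ \<theta> q (?\<omega> i)"
          by eventually_elim (use germ_mult_cancel_right in blast)
      qed
      have "((\<lambda>i. g (germ \<theta> (u * star t) (?\<omega> i))) \<longlongrightarrow> g (germ \<theta> (u * star t) w)) \<Phi>"
        by (rule tendsto_conv_algebra_germ[OF haus lim_act[OF w] sep_w germ_factor(1)[OF w u(2)] g])
      moreover have "\<forall>\<^sub>F i in \<Phi>. g (germ \<theta> (u * star t) (?\<omega> i))
          = conv_matrix g (germ \<theta> u (\<zeta> i)) (germ \<theta> t (\<zeta> i))"
        using \<omega> eventually_mem_source[OF lim u(2)]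
        by eventually_elim (simp add: quotient_germ)
      ultimately have "((\<lambda>i. conv_matrix g (germ \<theta> u (\<zeta> i)) (germ \<theta> t (\<zeta> i))) \<longlongrightarrow>
          g (germ \<theta> (u * star t) w)) \<Phi>"
        by (rule Lim_transform_eventually)
      then show ?thesis
        using quotient_germ[OF w u(2)] unfolding u(1)[symmetric] t(1)[symmetric]
        by (simp add: u_def t_def)
    qed
  qed
  then show ?thesis using left_regular_norm_le_iff[OF D(2,1) C] by blast
qed

end

section \<open>Points of \<open>X\<^sup>K\<^sup>S\<close> as filters of idempotents\<close>

definition idem_filter :: "'s::inverse_semigroup set \<Rightarrow> bool" where
  "idem_filter F \<longleftrightarrow> F \<noteq> {} \<and> F \<subseteq> idems \<and> (\<forall>e\<in>F. \<forall>f\<in>F. e * f \<in> F) \<and>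
     (\<forall>e\<in>F. \<forall>f\<in>idems. f * e = e \<longrightarrow> f \<in> F)"

text \<open>
  The point of \<open>X\<^sup>K\<^sup>S\<close> corresponding to the pair \<open>(F, x)\<close>.
\<close>

definition KS_char :: "'s::inverse_semigroup set \<Rightarrow> 'x \<Rightarrow> 's \<Rightarrow> 'x option" where
  "KS_char F x = (\<lambda>e\<in>idems. if e \<in> F then Some x else None)"

definition KS_filter :: "('s::inverse_semigroup \<Rightarrow> 'x \<rightharpoonup> 'x) \<Rightarrow> 's set \<Rightarrow> 'x \<Rightarrow> bool" where
  "KS_filter \<theta> F x \<longleftrightarrow> idem_filter F \<and> (\<forall>e\<in>F. x \<in> act_dom \<theta> e)"

lemma idem_filter_mult_iff:
  assumes F: "idem_filter F" and e: "e \<in> idems" and f: "f \<in> idems"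
  shows "e * f \<in> F \<longleftrightarrow> e \<in> F \<and> f \<in> F"
proof
  assume ef: "e * f \<in> F"
  have "e * (e * f) = e * f" using e by (simp add: idemsD flip: mult.assoc)
  moreover have "f * (e * f) = e * f"
    using e f by (simp add: idem_left_commute[of f e] idemsD)
  ultimately show "e \<in> F \<and> f \<in> F" using F e f ef unfolding idem_filter_def by blast
qed (use F in \<open>auto simp: idem_filter_def\<close>)

lemma idem_filter_idems: "idem_filter F \<Longrightarrow> e \<in> F \<Longrightarrow> e \<in> idems"
  by (auto simp: idem_filter_def)

lemma principal_idem_filter:
  assumes e: "e \<in> idems"
  shows "idem_filter {f \<in> idems. f * e = e}"
proof -
  have "f * (h * e) = e" if "f * e = e" "h * e = e" for f h using that by simp
  moreover have "h * e = e" if "f * e = e" "h * f = f" for f h using that by (metis mult.assoc)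
  ultimately show ?thesis
    using e by (auto simp: idem_filter_def idemsD mult.assoc)
qed

lemma KS_char_apply: "e \<in> idems \<Longrightarrow> KS_char F x e = (if e \<in> F then Some x else None)"
  by (simp add: KS_char_def)

lemma KS_point_eq: "e \<in> idems \<Longrightarrow> KS_point e x = KS_char {f \<in> idems. f * e = e} x"
  by (auto simp: KS_point_def KS_char_def nat_le_idem_iff)

text \<open>
  This filter belongs to the image under \<open>s\<close> of a point with filter \<open>F\<close>. It is closed under products because
  conjugation by \<open>s\<close> is multiplicative on idempotents; it contains \<open>ss\<^sup>*\<close>.
\<close>

lemma conj_idem_filter:
  assumes F: "idem_filter F" and s: "star s * s \<in> F"
  shows "idem_filter {e \<in> idems. star s * e * s \<in> F}"
proof -
  have mult: "star s * (e * f) * s = (star s * e * s) * (star s * f * s)"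
    if "e \<in> idems" "f \<in> idems" for e f
    using idem_conj[OF that(2), of s] by (simp add: mult.assoc)
  have "s * star s \<in> {e \<in> idems. star s * e * s \<in> F}"
    using s star_props(2)[of s] by (simp flip: mult.assoc)
  moreover have "e * f \<in> {e \<in> idems. star s * e * s \<in> F}"
    if "e \<in> {e \<in> idems. star s * e * s \<in> F}" "f \<in> {e \<in> idems. star s * e * s \<in> F}" for e f
    using that idem_filter_mult_iff[OF F, of "star s * e * s" "star s * f * s"] by (simp add: mult)
  moreover have "f \<in> {e \<in> idems. star s * e * s \<in> F}"
    if "e \<in> {e \<in> idems. star s * e * s \<in> F}" "f \<in> idems" "f * e = e" for e f
    using mult[of f e] that idem_filter_mult_iff[OF F, of "star s * f * s" "star s * e * s"] by simp
  ultimately show ?thesis unfolding idem_filter_def by blast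
qed

context inverse_semigroup_action
begin

abbreviation Z :: "('s \<Rightarrow> 'x option) topology" where
  "Z \<equiv> KS_space X \<theta>"

abbreviation K :: "'s \<Rightarrow> ('s \<Rightarrow> 'x option) \<rightharpoonup> ('s \<Rightarrow> 'x option)" where
  "K \<equiv> KS_act X \<theta>"

lemma topspace_KS_product:
  "topspace (KS_product X \<theta>) = (\<Pi>\<^sub>E e\<in>idems. insert None (Some ` (topspace X \<inter> act_dom \<theta> e)))"
  by (simp add: KS_product_def topspace_subtopology)

lemma topspace_KS_space: "topspace Z = KS_tilde X \<theta> - {KS_infinity}"
  by (auto simp: KS_space_def KS_tilde_def)

lemma KS_char_in_space:
  assumes "KS_filter \<theta> F x"
  shows "KS_char F x \<in> topspace Z"
proof -
  have F: "idem_filter F" and x: "\<And>e. e \<in> F \<Longrightarrow> x \<in> act_dom \<theta> e"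
    using assms by (auto simp: KS_filter_def)
  have "KS_char F x \<in> topspace (KS_product X \<theta>)"
    unfolding topspace_KS_product
    using x subsetD[OF openin_subset[OF open_act_dom[OF idem_filter_idems[OF F]]]]
    by (auto simp: KS_char_def)
  moreover have "KS_char F x e2 = KS_char F x e1"
    if "e1 \<in> idems" "e2 \<in> idems" "nat_le e1 e2" "KS_char F x e1 \<noteq> None" for e1 e2
  proof -
    have "e1 \<in> F" "e2 * e1 = e1" using that by (auto simp: KS_char_apply nat_le_idem_iff split: if_splits)
    then have "e2 \<in> F" using F that(2) by (auto simp: idem_filter_def)
    then show ?thesis using that \<open>e1 \<in> F\<close> by (simp add: KS_char_apply)
  qed
  moreover have "KS_char F x (e1 * e2) \<noteq> None"
    if "e1 \<in> idems" "e2 \<in> idems" "KS_char F x e1 \<noteq> None" "KS_char F x e2 \<noteq> None" for e1 e2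
    using that F by (simp add: KS_char_apply idem_filter_mult_iff split: if_splits)
  moreover have "KS_char F x \<noteq> KS_infinity"
  proof -
    obtain e where e: "e \<in> F" using F by (auto simp: idem_filter_def)
    then have "KS_char F x e \<noteq> KS_infinity e"
      using idem_filter_idems[OF F e] by (simp add: KS_char_apply KS_infinity_def)
    then show ?thesis by metis
  qed
  ultimately show ?thesis unfolding topspace_KS_space KS_tilde_def by blast
qed

text \<open>
  All finite coordinates of \<open>\<tau>\<close> agree, since \<open>\<tau>(e\<^sub>1)\<close> and \<open>\<tau>(e\<^sub>2)\<close> both equal \<open>\<tau>(e\<^sub>1e\<^sub>2)\<close>.
\<close>

lemma KS_space_cases:
  assumes "\<tau> \<in> topspace Z"
  obtains F x where "\<tau> = KS_char F x" "KS_filter \<theta> F x"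
proof -
  define F where "F = {e \<in> idems. \<tau> e \<noteq> None}"
  have tilde: "\<tau> \<in> KS_tilde X \<theta>" and ne: "\<tau> \<noteq> KS_infinity"
    using assms by (auto simp: topspace_KS_space)
  then have PiE: "\<tau> \<in> (\<Pi>\<^sub>E e\<in>idems. insert None (Some ` (topspace X \<inter> act_dom \<theta> e)))"
    unfolding KS_tilde_def topspace_KS_product by blast
  have up: "\<tau> e2 = \<tau> e1"
    if "e1 \<in> idems" "e2 \<in> idems" "e2 * e1 = e1" "\<tau> e1 \<noteq> None" for e1 e2
  proof -
    have "nat_le e1 e2" using that by (simp add: nat_le_idem_iff)
    then show ?thesis using tilde that unfolding KS_tilde_def by blast
  qed
  have mult: "\<tau> (e1 * e2) \<noteq> None"
    if "e1 \<in> idems" "e2 \<in> idems" "\<tau> e1 \<noteq> None" "\<tau> e2 \<noteq> None" for e1 e2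
    using tilde that unfolding KS_tilde_def by blast
  have ext: "\<tau> \<in> extensional idems" using PiE by (auto simp: PiE_def)
  have "F \<noteq> {}"
  proof
    assume "F = {}"
    then have "\<tau> = KS_infinity"
      using ext by (auto simp: F_def KS_infinity_def extensional_def restrict_def)
    with ne show False ..
  qed
  then obtain e0 x where e0: "e0 \<in> F" "\<tau> e0 = Some x" by (auto simp: F_def)
  have val: "\<tau> e = Some x" if "e \<in> F" for e
  proof -
    have e: "e \<in> idems" "\<tau> e \<noteq> None" "e0 \<in> idems" "\<tau> e0 \<noteq> None"
      using that e0 by (auto simp: F_def)
    have "e * (e * e0) = e * e0" using e by (simp add: idemsD flip: mult.assoc)
    moreover have "e0 * (e * e0) = e * e0" using e by (simp add: idem_left_commute[of e0 e] idemsD)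
    ultimately have "\<tau> e = \<tau> (e * e0)" "\<tau> e0 = \<tau> (e * e0)"
      using up[of "e * e0"] mult[of e e0] e by simp_all
    then show ?thesis using e0 by simp
  qed
  have eq: "\<tau> = KS_char F x"
  proof
    fix e
    show "\<tau> e = KS_char F x e"
    proof (cases "e \<in> idems")
      case True
      then show ?thesis using val by (auto simp: KS_char_apply F_def)
    next
      case False
      then show ?thesis using ext by (simp add: KS_char_def extensional_def)
    qed
  qed
  have "idem_filter F"
    using \<open>F \<noteq> {}\<close> mult up unfolding idem_filter_def by (fastforce simp: F_def)
  moreover have "x \<in> act_dom \<theta> e" if "e \<in> F" for e
  proof -
    have "\<tau> e \<in> insert None (Some ` (topspace X \<inter> act_dom \<theta> e))"
      using PiE that by (auto simp: F_def)
    then show ?thesis using val[OF that] by auto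
  qed
  ultimately show ?thesis using eq that by (simp add: KS_filter_def)
qed

lemma KS_point_in_space:
  assumes e: "e \<in> idems" and x: "x \<in> act_dom \<theta> e"
  shows "KS_filter \<theta> {f \<in> idems. f * e = e} x" and "KS_point e x \<in> topspace Z"
proof -
  have "x \<in> act_dom \<theta> f" if "f \<in> idems" "f * e = e" for f
    using act_dom_mult[OF that(1) e] that(2) x by (metis IntD1)
  then show "KS_filter \<theta> {f \<in> idems. f * e = e} x"
    using principal_idem_filter[OF e] by (simp add: KS_filter_def)
  then show "KS_point e x \<in> topspace Z" using KS_char_in_space e by (simp add: KS_point_eq)
qed

lemma KS_filter_conj:
  assumes "KS_filter \<theta> F x" "star s * s \<in> F" "\<theta> s x = Some y"
  shows "KS_filter \<theta> {e \<in> idems. star s * e * s \<in> F} y"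
  using assms conj_idem_filter[of F s] act_dom_conj[OF assms(3)] by (auto simp: KS_filter_def)

lemma KS_act_None:
  assumes "KS_filter \<theta> F x" "star s * s \<notin> F"
  shows "K s (KS_char F x) = None"
  using assms by (simp add: KS_act_def KS_char_apply)

text \<open>
  In terms of pairs, \<open>s\<close> maps \<open>(F, x)\<close> to \<open>({e | s\<^sup>*es \<in> F}, \<theta>\<^sub>s(x))\<close>.
\<close>

lemma KS_act_Some:
  assumes F: "KS_filter \<theta> F x" and s: "star s * s \<in> F" and y: "\<theta> s x = Some y"
  shows "K s (KS_char F x) = Some (KS_char {e \<in> idems. star s * e * s \<in> F} y)"
proof -
  have "\<theta> (e * s) x = Some y" if e: "e \<in> idems" "star s * e * s \<in> F" for e
  proof -
    have "x \<in> act_dom \<theta> (star s * e * s)" using F e(2) by (auto simp: KS_filter_def)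
    then have "\<theta> e y = Some y" using act_dom_conj[OF y e(1)] by (simp add: mem_act_dom)
    then show ?thesis using y by (simp add: act_mult_Some)
  qed
  then show ?thesis
    using s KS_char_in_space[OF F]
    by (auto simp: KS_act_def KS_char_apply KS_char_def[of _ y] intro!: restrict_ext)
qed

lemma KS_filter_source:
  assumes "KS_filter \<theta> F x" "star s * s \<in> F"
  obtains y where "\<theta> s x = Some y"
  using assms mem_source by (fastforce simp: KS_filter_def)

lemma KS_act_mult: "K (s * t) = K s \<circ>\<^sub>m K t"
proof
  fix \<tau>
  show "K (s * t) \<tau> = (K s \<circ>\<^sub>m K t) \<tau>"
  proof (cases "\<tau> \<in> topspace Z")
    case False
    then show ?thesis by (simp add: KS_act_def)
  next
    case True
    then obtain F x where \<tau>: "\<tau> = KS_char F x" and F: "KS_filter \<theta> F x" by (rule KS_space_cases)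
    have fil: "idem_filter F" using F by (simp add: KS_filter_def)
    have source: "star (s * t) * (s * t) \<in> F \<longleftrightarrow> star t * t \<in> F \<and> star t * (star s * s) * t \<in> F"
    proof -
      have "star t * t * (star t * (star s * s) * t) = star t * (star s * s) * t"
        by (simp add: star_props flip: mult.assoc)
      then show ?thesis
        using idem_filter_mult_iff[OF fil, of "star t * t" "star t * (star s * s) * t"]
        by (simp add: source_mult)
    qed
    show ?thesis
    proof (cases "star t * t \<in> F")
      case False
      then show ?thesis using source F by (simp add: \<tau> KS_act_None)
    next
      case t: True
      obtain y where y: "\<theta> t x = Some y" using F t by (rule KS_filter_source)
      let ?F = "{e \<in> idems. star t * e * t \<in> F}"
      have F': "KS_filter \<theta> ?F y" by (rule KS_filter_conj[OF F t y])
      have Kt: "K t \<tau> = Some (KS_char ?F y)" unfolding \<tau> by (rule KS_act_Some[OF F t y])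
      show ?thesis
      proof (cases "star s * s \<in> ?F")
        case False
        then show ?thesis using source F F' Kt by (simp add: \<tau> KS_act_None)
      next
        case s: True
        obtain z where z: "\<theta> s y = Some z" using F' s by (rule KS_filter_source)
        have "{e \<in> idems. star (s * t) * e * (s * t) \<in> F} = {e \<in> idems. star s * e * s \<in> ?F}"
          by (auto simp: star_mult mult.assoc) (auto simp flip: mult.assoc)
        moreover have "\<theta> (s * t) x = Some z" using y z by (simp add: act_mult_Some)
        ultimately have "K (s * t) \<tau> = Some (KS_char {e \<in> idems. star s * e * s \<in> ?F} z)"
          unfolding \<tau> using KS_act_Some[OF F, of "s * t" z] source s t by simp
        also have "\<dots> = K s (KS_char ?F y)" by (rule KS_act_Some[OF F' s z, symmetric])
        finally show ?thesis by (simp add: Kt)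
      qed
    qed
  qed
qed

lemma KS_act_idem:
  assumes F: "KS_filter \<theta> F x" and e: "e \<in> F"
  shows "K e (KS_char F x) = Some (KS_char F x)"
proof -
  have fil: "idem_filter F" using F by (simp add: KS_filter_def)
  have ei: "e \<in> idems" by (rule idem_filter_idems[OF fil e])
  have "{f \<in> idems. star e * f * e \<in> F} = F"
    using fil ei e idem_filter_idems[OF fil] by (auto simp: idem_filter_mult_iff)
  moreover have "\<theta> e x = Some x" using F e by (simp add: KS_filter_def mem_act_dom)
  ultimately show ?thesis using KS_act_Some[OF F, of e x] e ei by (simp add: idemsD)
qed

lemma KS_act_dom:
  assumes "e \<in> idems"
  shows "act_dom K e = {\<tau> \<in> topspace Z. \<tau> e \<noteq> None}"
proof -
  have "\<tau> \<in> act_dom K e" if \<tau>: "\<tau> \<in> topspace Z" "\<tau> e \<noteq> None" for \<tau>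
  proof -
    obtain F x where F: "\<tau> = KS_char F x" "KS_filter \<theta> F x" using KS_space_cases[OF \<tau>(1)] by blast
    then have "e \<in> F" using \<tau>(2) assms by (simp add: KS_char_apply split: if_splits)
    then show ?thesis using KS_act_idem F by (simp add: act_dom_def)
  qed
  then show ?thesis
    using assms by (auto simp: act_dom_def KS_act_def idemsD split: if_splits)
qed

lemma mem_KS_act_dom:
  assumes "KS_filter \<theta> F x" "e \<in> idems"
  shows "KS_char F x \<in> act_dom K e \<longleftrightarrow> e \<in> F"
  using assms KS_char_in_space[OF assms(1)] by (simp add: KS_act_dom KS_char_apply)

lemma open_KS_act_dom:
  assumes "e \<in> idems"
  shows "openin Z (act_dom K e)"
proof -
  let ?A = "Alexandroff_compactification (subtopology X (act_dom \<theta> e))"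
  have "continuous_map Z ?A (\<lambda>\<tau>. \<tau> e)"
    unfolding KS_space_def KS_product_def
    by (intro continuous_map_from_subtopology continuous_map_product_projection assms)
  moreover have "openin ?A (Some ` act_dom \<theta> e)"
    using openin_subset[OF open_act_dom[OF assms]]
    by (simp add: openin_subtopology) (metis Int_absorb open_act_dom[OF assms])
  ultimately have "openin Z {\<tau> \<in> topspace Z. \<tau> e \<in> Some ` act_dom \<theta> e}"
    by (rule openin_continuous_map_preimage)
  also have "{\<tau> \<in> topspace Z. \<tau> e \<in> Some ` act_dom \<theta> e} = act_dom K e"
  proof -
    have "\<tau> e \<in> Some ` act_dom \<theta> e" if "\<tau> \<in> topspace Z" "\<tau> e \<noteq> None" for \<tau>
      using that assms by (elim KS_space_cases) (auto simp: KS_char_apply KS_filter_def split: if_splits)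
    then show ?thesis using KS_act_dom[OF assms] by auto
  qed
  finally show ?thesis .
qed

lemma KS_partial_action: "partial_action Z K"
proof
  show "dom (K s) \<subseteq> topspace Z" for s
    by (auto simp: KS_act_def split: if_splits)
  show "inj_on (K s) (dom (K s))" for s
  proof -
    have inverse: "K (star s) \<upsilon> = Some \<tau>" if \<tau>: "K s \<tau> = Some \<upsilon>" for \<tau> \<upsilon>
    proof -
      have "\<tau> \<in> topspace Z" "\<tau> (star s * s) \<noteq> None"
        using \<tau> by (auto simp: KS_act_def split: if_splits)
      then have "K (star s * s) \<tau> = Some \<tau>" using KS_act_dom[of "star s * s"] by (auto simp: act_dom_def)
      then show ?thesis using \<tau> by (simp add: KS_act_mult)
    qed
    show ?thesis
    proof (rule inj_onI)
      fix \<tau> \<tau>' assume "\<tau> \<in> dom (K s)" "\<tau>' \<in> dom (K s)" "K s \<tau> = K s \<tau>'"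
      then show "\<tau> = \<tau>'" using inverse by (metis domD option.inject)
    qed
  qed
qed (simp_all add: KS_act_mult open_KS_act_dom)

sublocale KS: partial_action Z K
  by (rule KS_partial_action)

text \<open>
  The one-point compactification of \<open>X\<^sub>e\<close> is Hausdorff because \<open>X\<^sub>e\<close>, being open in \<open>X\<close>, is locally compact.
\<close>

lemma Hausdorff_KS_space:
  assumes "locally_compact_space X" "Hausdorff_space X"
  shows "Hausdorff_space Z"
proof -
  have "Hausdorff_space (Alexandroff_compactification (subtopology X (act_dom \<theta> e)))"
    if "e \<in> idems" for e
    using assms open_act_dom[OF that] unfolding Hausdorff_space_Alexandroff_compactification
    by (simp add: Hausdorff_space_subtopology locally_compact_space_open_subset)
  then show ?thesis
    unfolding KS_space_def KS_product_def
    by (intro Hausdorff_space_subtopology) (simp add: Hausdorff_space_product_topology)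
qed

section \<open>Approximation by the points \<open>\<tau>\<^sub>e\<^sub>,\<^sub>x\<close>\<close>

text \<open>
  The filter of sections of \<open>F\<close> directed downwards: limits along it are limits as \<open>e \<in> F\<close> decreases.
\<close>

definition down :: "'s set \<Rightarrow> 's filter" where
  "down F = (INF f\<in>F. principal {e \<in> F. f * e = e})"

lemma eventually_down:
  assumes F: "idem_filter F"
  shows "eventually P (down F) \<longleftrightarrow> (\<exists>f\<in>F. \<forall>e\<in>F. f * e = e \<longrightarrow> P e)"
proof -
  have "eventually P (down F) \<longleftrightarrow> (\<exists>f\<in>F. eventually P (principal {e \<in> F. f * e = e}))"
    unfolding down_def
  proof (rule eventually_INF_base)
    show "F \<noteq> {}" using F by (simp add: idem_filter_def)
    fix a b assume ab: "a \<in> F" "b \<in> F"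
    then have i: "a \<in> idems" "b \<in> idems" using F by (auto simp: idem_filter_def)
    have "a * e = e \<and> b * e = e" if e: "a * b * e = e" for e
    proof
      have "a * (a * b * e) = a * b * e" using i by (simp add: idemsD flip: mult.assoc)
      then show "a * e = e" using e by simp
      have "b * (a * b * e) = a * b * e"
        using i by (simp add: mult.assoc idem_left_commute[of b a]) (simp add: idemsD flip: mult.assoc)
      then show "b * e = e" using e by simp
    qed
    then have "principal {e \<in> F. a * b * e = e}
        \<le> inf (principal {e \<in> F. a * e = e}) (principal {e \<in> F. b * e = e})"
      by auto
    moreover have "a * b \<in> F" using F ab by (simp add: idem_filter_def)
    ultimately show "\<exists>x\<in>F. principal {e \<in> F. x * e = e}
        \<le> inf (principal {e \<in> F. a * e = e}) (principal {e \<in> F. b * e = e})"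
      by blast
  qed
  then show ?thesis by (auto simp: eventually_principal)
qed

lemma down_neq_bot:
  assumes F: "idem_filter F"
  shows "down F \<noteq> bot"
proof -
  have "\<not> eventually (\<lambda>_. False) (down F)"
    unfolding eventually_down[OF F] using idemsD[OF idem_filter_idems[OF F]] by blast
  then show ?thesis by (simp add: trivial_limit_def)
qed

text \<open>
  This is why the coordinates of \<open>\<tau>\<^sub>e\<^sub>,\<^sub>x\<close> stabilise at those of \<open>(F, x)\<close>: \<open>\<tau>\<^sub>e\<^sub>,\<^sub>x(f)\<close> is finite iff \<open>e \<le> f\<close>. For \<open>f \<in> F\<close> this
  holds for all small \<open>e\<close>, and for \<open>f \<notin> F\<close> it holds for no \<open>e \<in> F\<close> because \<open>F\<close> is upward closed.
\<close>

lemma eventually_down_le: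
  assumes F: "idem_filter F" and f: "f \<in> idems"
  shows "\<forall>\<^sub>F e in down F. f * e = e \<longleftrightarrow> f \<in> F"
proof (cases "f \<in> F")
  case True
  then show ?thesis by (auto simp: eventually_down[OF F])
next
  case False
  then have "f * e \<noteq> e" if "e \<in> F" for e using F f that by (auto simp: idem_filter_def)
  then show ?thesis using F False by (auto simp: eventually_down[OF F] idem_filter_def)
qed

lemma eventually_down_mem: "idem_filter F \<Longrightarrow> \<forall>\<^sub>F e in down F. e \<in> F"
  by (auto simp: eventually_down idem_filter_def)

lemma limitin_KS_space:
  assumes \<sigma>: "\<sigma> \<in> topspace Z" and ev: "\<forall>\<^sub>F i in \<Phi>. \<rho> i \<in> topspace Z"
    and eq: "\<And>f. f \<in> idems \<Longrightarrow> \<forall>\<^sub>F i in \<Phi>. \<rho> i f = \<sigma> f"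
  shows "limitin Z \<rho> \<sigma> \<Phi>"
proof -
  have prod: "\<sigma> \<in> topspace (KS_product X \<theta>)" "\<sigma> \<in> KS_tilde X \<theta> - {KS_infinity}"
    "\<forall>\<^sub>F i in \<Phi>. \<rho> i \<in> topspace (KS_product X \<theta>)" "\<forall>\<^sub>F i in \<Phi>. \<rho> i \<in> KS_tilde X \<theta> - {KS_infinity}"
    using \<sigma> ev unfolding KS_space_def topspace_subtopology by (auto elim: eventually_mono)
  have "limitin (KS_product X \<theta>) \<rho> \<sigma> \<Phi>"
    unfolding KS_product_def limitin_componentwise
  proof (intro conjI ballI)
    show "\<sigma> \<in> extensional idems" using prod(1) unfolding topspace_KS_product by (auto simp: PiE_def)
    show "\<forall>\<^sub>F i in \<Phi>. \<rho> i \<in> topspace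
        (product_topology (\<lambda>e. Alexandroff_compactification (subtopology X (act_dom \<theta> e))) idems)"
      using prod(3) unfolding KS_product_def .
    fix f :: 's assume f: "f \<in> idems"
    show "limitin (Alexandroff_compactification (subtopology X (act_dom \<theta> f))) (\<lambda>i. \<rho> i f) (\<sigma> f) \<Phi>"
    proof (rule limitin_eventually[OF _ eq[OF f]])
      show "\<sigma> f \<in> topspace (Alexandroff_compactification (subtopology X (act_dom \<theta> f)))"
        using prod(1) f unfolding topspace_KS_product by auto
    qed
  qed
  then show ?thesis using prod by (simp add: KS_space_def limitin_subtopology)
qed

lemma KS_point_limit:
  assumes F: "KS_filter \<theta> F x"
  shows "limitin Z (\<lambda>e. KS_point e x) (KS_char F x) (down F)"
proof (rule limitin_KS_space[OF KS_char_in_space[OF F]])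
  have fil: "idem_filter F" using F by (simp add: KS_filter_def)
  show "\<forall>\<^sub>F e in down F. KS_point e x \<in> topspace Z"
    using eventually_down_mem[OF fil] by (rule eventually_mono)
      (use F KS_point_in_space(2) in \<open>auto simp: KS_filter_def idem_filter_def\<close>)
  show "\<forall>\<^sub>F e in down F. KS_point e x f = KS_char F x f" if f: "f \<in> idems" for f
    using eventually_down_mem[OF fil] eventually_down_le[OF fil f]
    by eventually_elim (use f idem_filter_idems[OF fil] in \<open>auto simp: KS_point_eq KS_char_apply\<close>)
qed

text \<open>
  The coordinate at \<open>f\<close> of the image under \<open>t\<close> depends only on the coordinate at \<open>t\<^sup>*ft\<close> and on \<open>\<theta>\<^sub>t(x)\<close>, so it
  stabilises as well.
\<close>

lemma KS_act_point_limit: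
  assumes F: "KS_filter \<theta> F x" and t: "K t (KS_char F x) = Some \<sigma>"
  shows "limitin Z (\<lambda>e. the (K t (KS_point e x))) \<sigma> (down F)"
proof -
  have fil: "idem_filter F" using F by (simp add: KS_filter_def)
  have tF: "star t * t \<in> F" using t KS_act_None[OF F, of t] by fastforce
  obtain y where y: "\<theta> t x = Some y" using F tF by (rule KS_filter_source)
  have \<sigma>: "\<sigma> = KS_char {f \<in> idems. star t * f * t \<in> F} y"
    using KS_act_Some[OF F tF y] t by simp
  have point: "\<forall>\<^sub>F e in down F. KS_filter \<theta> {f \<in> idems. (star t * f * t) * e = e} y \<and>
      K t (KS_point e x) = Some (KS_char {f \<in> idems. (star t * f * t) * e = e} y)"
    using eventually_down_mem[OF fil] eventually_down_le[OF fil star_mult_idems(1)[of t]]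
  proof eventually_elim
    case (elim e)
    have e: "e \<in> idems" by (rule idem_filter_idems[OF fil elim(1)])
    have "x \<in> act_dom \<theta> e" using F elim(1) by (simp add: KS_filter_def)
    then have Fe: "KS_filter \<theta> {f \<in> idems. f * e = e} x" by (rule KS_point_in_space(1)[OF e])
    have te: "star t * t \<in> {f \<in> idems. f * e = e}" using elim(2) tF by simp
    have "{f \<in> idems. star t * f * t \<in> {f \<in> idems. f * e = e}}
        = {f \<in> idems. (star t * f * t) * e = e}"
      by auto
    then show ?case
      using KS_act_Some[OF Fe te y] KS_filter_conj[OF Fe te y] e by (simp add: KS_point_eq)
  qed
  show ?thesis
  proof (rule limitin_KS_space)
    show "\<sigma> \<in> topspace Z" unfolding \<sigma> by (rule KS_char_in_space[OF KS_filter_conj[OF F tF y]])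
    show "\<forall>\<^sub>F e in down F. the (K t (KS_point e x)) \<in> topspace Z"
      using point by eventually_elim (auto intro: KS_char_in_space)
    show "\<forall>\<^sub>F e in down F. the (K t (KS_point e x)) f = \<sigma> f" if f: "f \<in> idems" for f
      using point eventually_down_le[OF fil conj_idems[OF f, of t]]
      by eventually_elim (simp add: \<sigma> KS_char_apply f)
  qed
qed

text \<open>
  An idempotent \<open>h\<close> with \<open>sh = th\<close> that witnesses equality of germs at \<open>\<tau>\<^sub>e\<^sub>,\<^sub>x\<close> satisfies \<open>e \<le> h\<close>, so \<open>se = te\<close>. As
  \<open>e \<in> F\<close>, the idempotent \<open>e\<close> witnesses equality of the germs at \<open>(F, x)\<close>.
\<close>

lemma KS_point_separates_germs:
  assumes F: "KS_filter \<theta> F x"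
  shows "KS.separates_germs (\<lambda>e. KS_point e x) (KS_char F x) (down F)"
  unfolding KS.separates_germs_def
proof (intro allI impI)
  fix s t assume s: "KS_char F x \<in> KS.source s" and t: "KS_char F x \<in> KS.source t"
    and ne: "germ K s (KS_char F x) \<noteq> germ K t (KS_char F x)"
  have fil: "idem_filter F" using F by (simp add: KS_filter_def)
  note lim = KS_point_limit[OF F]
  from eventually_down_mem[OF fil] KS.eventually_mem_source[OF lim s] KS.eventually_mem_source[OF lim t]
  show "\<forall>\<^sub>F e in down F. germ K s (KS_point e x) \<noteq> germ K t (KS_point e x)"
  proof eventually_elim
    case (elim e)
    have e: "e \<in> idems" by (rule idem_filter_idems[OF fil elim(1)])
    have "x \<in> act_dom \<theta> e" using F elim(1) by (simp add: KS_filter_def)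
    then have Fe: "KS_filter \<theta> {f \<in> idems. f * e = e} x" by (rule KS_point_in_space(1)[OF e])
    show ?case
    proof
      assume "germ K s (KS_point e x) = germ K t (KS_point e x)"
      then obtain h where h: "h \<in> idems" "s * h = t * h" "KS_point e x \<in> act_dom K h"
        using KS.germ_eq_iff[OF elim(2,3)] by blast
      then have "h * e = e" using mem_KS_act_dom[OF Fe h(1)] e by (simp add: KS_point_eq)
      then have "s * e = t * e" using h(2) by (metis mult.assoc)
      moreover have "KS_char F x \<in> act_dom K e" using mem_KS_act_dom[OF F e] elim(1) by simp
      ultimately show False using KS.germ_eq_iff[OF s t] e ne by blast
    qed
  qed
qed

end

theorem proposition4p2p2:
  fixes X :: "'x topology"
    and \<theta> :: "'s::inverse_semigroup \<Rightarrow> 'x \<rightharpoonup> 'x"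
    and g :: "('s \<times> ('s \<Rightarrow> 'x option)) set \<Rightarrow> complex"
  assumes "locally_compact_space X"
    and "Hausdorff_space X"
    and "inverse_semigroup_action X \<theta>"
    and "g \<in> conv_algebra (transformation_groupoid (KS_space X \<theta>) (KS_act X \<theta>))"
  shows "reduced_norm (transformation_groupoid (KS_space X \<theta>) (KS_act X \<theta>)) g =
    Sup {left_regular_norm (transformation_groupoid (KS_space X \<theta>) (KS_act X \<theta>)) (KS_point e x) g
         | e x. e \<in> idems \<and> x \<in> act_dom \<theta> e}"
proof -
  interpret inverse_semigroup_action X \<theta> by (rule assms(3))
  let ?\<nu> = "\<lambda>\<tau>. left_regular_norm KS.G \<tau> g"
  let ?L = "{?\<nu> \<tau> | \<tau>. \<tau> \<in> topspace Z}"
  let ?R = "{?\<nu> (KS_point e x) | e x. e \<in> idems \<and> x \<in> act_dom \<theta> e}"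
  obtain C where C: "0 \<le> C" "\<And>\<tau>. sections_bounded (src_fiber KS.G \<tau>) (KS.conv_matrix g) C"
    using KS.conv_algebra_sections_bounded[OF assms(4)] by blast
  have le_C: "?\<nu> \<tau> \<le> C" for \<tau>
    using KS.left_regular_norm_le_iff[OF C(2) C(1) C(1)] C(2) by blast
  have bdd: "bdd_above ?R" by (rule bdd_aboveI[of _ C]) (use le_C in auto)
  have sub: "?R \<subseteq> ?L" using KS_point_in_space(2) by blast
  have le: "?\<nu> \<tau> \<le> Sup ?R" if \<tau>: "\<tau> \<in> topspace Z" for \<tau>
  proof -
    obtain F x where \<tau>: "\<tau> = KS_char F x" and F: "KS_filter \<theta> F x"
      using \<tau> by (rule KS_space_cases)
    have fil: "idem_filter F" using F by (simp add: KS_filter_def)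
    have point: "?\<nu> (KS_point e x) \<le> Sup ?R" if e: "e \<in> F" for e
    proof (rule cSup_upper[OF _ bdd])
      have "e \<in> idems" "x \<in> act_dom \<theta> e" using F e idem_filter_idems[OF fil] by (auto simp: KS_filter_def)
      then show "?\<nu> (KS_point e x) \<in> ?R" by blast
    qed
    have ev: "\<forall>\<^sub>F e in down F. ?\<nu> (KS_point e x) \<le> Sup ?R"
      using eventually_down_mem[OF fil] by eventually_elim (rule point)
    \<comment> \<open>Norms are nonnegative, so the supremum is too: the set contains the norm at some \<open>\<tau>\<^sub>e\<^sub>,\<^sub>x\<close>.\<close>
    obtain e where "e \<in> F" using fil by (auto simp: idem_filter_def)
    then have "0 \<le> Sup ?R"
      using point KS.left_regular_norm_nonneg[OF C(2,1)] order_trans by blast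
    then show ?thesis
      unfolding \<tau>
      using KS.left_regular_norm_le_limit[OF Hausdorff_KS_space[OF assms(1,2)] assms(4)
          down_neq_bot[OF fil] KS_point_limit[OF F] KS_act_point_limit[OF F]
          KS_point_separates_germs[OF F] _ ev]
      by blast
  qed
  have "Sup ?L = Sup ?R"
  \<comment> \<open>If \<open>X\<^sup>K\<^sup>S\<close> is empty, both suprema are over the empty set.\<close>
  proof (cases "?L = {}")
    case True
    then have "?L = ?R" using sub by blast
    then show ?thesis by (rule arg_cong[where f = Sup])
  next
    case False
    then obtain \<tau> where \<tau>: "\<tau> \<in> topspace Z" by blast
    obtain F x where F: "KS_filter \<theta> F x" using KS_space_cases[OF \<tau>] by blast
    then obtain e where "e \<in> F" by (auto simp: KS_filter_def idem_filter_def)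
    then have "e \<in> idems" "x \<in> act_dom \<theta> e" using F by (auto simp: KS_filter_def idem_filter_def)
    then have ne: "?R \<noteq> {}" by blast
    show ?thesis
    proof (rule antisym)
      show "Sup ?L \<le> Sup ?R" by (rule cSup_least[OF False]) (use le in blast)
      show "Sup ?R \<le> Sup ?L"
        by (rule cSup_subset_mono[OF ne _ sub]) (rule bdd_aboveI[of _ C], use le_C in auto)
    qed
  qed
  then show ?thesis by (simp add: reduced_norm_def transformation_groupoid_def)
qed

end
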